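(* Let $f_0,F:\mathbb{R}^n\times\mathbb{R}^d\to\mathbb{R}$ be twice continuously differentiable functions. For $w\in\mathbb{R}^d$ put $C(w)=\{x\in\mathbb{R}^n\mid F(x,w)\le 0\}$ and $$S(w)=\{x\in\mathbb{R}^n\mid 0\in\nabla_xf_0(x,w)+N_{C(w)}(x)\}.$$ Let $\bar w\in\mathbb{R}^d$ and $\bar x\in S(\bar w)$. Suppose that $F(\bar x,\bar w)=0$, that $\nabla_xF(\bar x,\bar w)\neq 0$, and that the unique $\lambda\ge 0$ with $\nabla_xf_0(\bar x,\bar w)+\lambda\nabla_xF(\bar x,\bar w)=0$ is positive. Put $$A_1=\left[\nabla^2_{xx}f_0(\bar x,\bar w)+\lambda\nabla^2_{xx}F(\bar x,\bar w)\quad \nabla_xF(\bar x,\bar w)\right]\in\mathbb{R}^{n\times(n+1)},$$ $$A_2=\left[\nabla^2_{wx}f_0(\bar x,\bar w)+\lambda\nabla^2_{wx}F(\bar x,\bar w)\quad \nabla_wF(\bar x,\bar w)\right]\in\mathbb{R}^{d\times(n+1)}.$$ For $x'\in\mathbb{R}^n$ let $\Gamma_2(x')$ be the set of all $w'\in\mathbb{R}^d$ for which there exist $v'_1\in\mathbb{R}^n$ and $\gamma\in\mathbb{R}$ with $$\begin{cases}w'=\left[\nabla^2_{wx}f_0(\bar x,\bar w)+\lambda\nabla^2_{wx}F(\bar x,\bar w)\right]v'_1+\gamma\nabla_wF(\bar x,\bar w),\\ \left[\nabla^2_{xx}f_0(\bar x,\bar w)+\lambda\nabla^2_{xx}F(\bar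 x,\bar w)\right]v'_1+\gamma\nabla_xF(\bar x,\bar w)=-x',\\ \nabla_xF(\bar x,\bar w)v'_1=0.\end{cases}$$ Put $M(x,w)=N_{C(w)}(x)$, $\bar\tau=(\bar x,\bar w,-\nabla_xf_0(\bar x,\bar w))\in\mathrm{gph}\,M$, and $$\widehat\Gamma(x')=\bigcup_{v'_1\in\mathbb{R}^n}\left\{w'\in\mathbb{R}^d\mid(-x',w')\in\left(\nabla^2_{xx}f_0(\bar x,\bar w)v'_1,\nabla^2_{wx}f_0(\bar x,\bar w)v'_1\right)+\widehat D^*M(\bar\tau)(v'_1)\right\}.$$ If $$\ker A_1\cap\ker A_2\cap\left(\ker\nabla_xF(\bar x,\bar w)\times\mathbb{R}\right)=\{(0,0)\},$$ then for every $x'\in\mathbb{R}^n$ $$\widehat\Gamma(x')=\widehat D^*S(\bar w|\bar x)(x')=D^*S(\bar w|\bar x)(x')=\Gamma_2(x').$$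
   Context: Fréchet normal cone: for $\Omega\subset\mathbb{R}^s$ and $\bar v\in\Omega$, $\widehat N_\Omega(\bar v)=\{v'\in\mathbb{R}^s\mid \limsup_{v\to\bar v,\,v\in\Omega}\frac{\langle v',v-\bar v\rangle}{\|v-\bar v\|}\le 0\}$, and $\widehat N_\Omega(\bar v)=\emptyset$ if $\bar v\notin\Omega$. Mordukhovich (limiting) normal cone, for $\Omega$ locally closed around $\bar v\in\Omega$: $N_\Omega(\bar v)$ is the set of all $v'$ for which there are sequences $v_k\to\bar v$, $v'_k\to v'$ with $v'_k\in\widehat N_\Omega(v_k)$ for all $k$; $N_\Omega(\bar v)=\emptyset$ if $\bar v\notin\Omega$. Coderivatives: for a multifunction $\Phi:\mathbb{R}^p\rightrightarrows\mathbb{R}^q$ and $(\bar u,\bar y)\in\mathrm{gph}\,\Phi=\{(u,y)\mid y\in\Phi(u)\}$, the Fréchet coderivative is $\widehat D^*\Phi(\bar u|\bar y)(y')=\{u'\in\mathbb{R}^p\mid(u',-y')\in\widehat N_{\mathrm{gph}\,\Phi}(\bar u,\bar y)\}$ and the Mordukhovich coderivative is $D^*\Phi(\bar u|\bar y)(y')=\{u'\in\mathbb{R}^p\mid(u',-y')\in N_{\mathrm{gph}\,\Phi}(\bar u,\bar y)\}$, $y'\in\mathbb{R}^q$. For $M:\mathbb{R}^n\times\mathbb{R}^d\rightrightarrows\mathbb{R}^n$, the value $\widehat D^*M(\bar\tau)(v'_1)$ is a subset of $\mathbb{R}^n\times\mathbb{R}^d$. For a function $h(x,w)$, $\nabla^2_{xx}h$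 is the $n\times n$ Hessian in $x$ and $\nabla^2_{wx}h$ is the $d\times n$ matrix with entries $\partial^2h/\partial w_i\partial x_j$. Gradients $\nabla_xF(\bar x,\bar w)$ and $\nabla_wF(\bar x,\bar w)$ are column vectors in $A_1,A_2$, which act on pairs $(v'_1,\gamma)\in\mathbb{R}^n\times\mathbb{R}$; $\nabla_xF(\bar x,\bar w)v'_1$ means $\langle\nabla_xF(\bar x,\bar w),v'_1\rangle$, and $\ker\nabla_xF(\bar x,\bar w)$ is the set of $v'_1\in\mathbb{R}^n$ where it vanishes. *)

theory Defs
  imports "HOL-Analysis.Analysis" "HOL-Library.Set_Algebras"
begin

text \<open>
  The upper limit is taken along the punctured filter and in the extended reals; at an isolated
  point of the set that filter is trivial, the upper limit is minus infinity, and every vector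
  is normal.
\<close>

definition frechet_normal_cone :: "'a::euclidean_space set \<Rightarrow> 'a \<Rightarrow> 'a set" where
  "frechet_normal_cone \<Omega> v =
     (if v \<in> \<Omega>
      then {v'. Limsup (at v within \<Omega>) (\<lambda>u. ereal (v' \<bullet> (u - v) / norm (u - v))) \<le> 0}
      else {})"

text \<open>
  The Mordukhovich cone is usually introduced only for sets that are closed around the point.
  The same formula is used here without that restriction.
\<close>

definition limiting_normal_cone :: "'a::euclidean_space set \<Rightarrow> 'a \<Rightarrow> 'a set" where
  "limiting_normal_cone \<Omega> v =
     (if v \<in> \<Omega>
      then {v'. \<exists>V V'. V \<longlonglongrightarrow> v \<and> V' \<longlonglongrightarrow> v' \<and> (\<forall>k::nat. V' k \<in> frechet_normal_cone \<Omega> (V k))}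
      else {})"

definition gph :: "('a \<Rightarrow> 'b set) \<Rightarrow> ('a \<times> 'b) set" where
  "gph \<Phi> = {(u, y). y \<in> \<Phi> u}"

definition frechet_coderivative ::
    "('a::euclidean_space \<Rightarrow> 'b::euclidean_space set) \<Rightarrow> 'a \<Rightarrow> 'b \<Rightarrow> 'b \<Rightarrow> 'a set" where
  "frechet_coderivative \<Phi> u y y' = {u'. (u', - y') \<in> frechet_normal_cone (gph \<Phi>) (u, y)}"

definition limiting_coderivative ::
    "('a::euclidean_space \<Rightarrow> 'b::euclidean_space set) \<Rightarrow> 'a \<Rightarrow> 'b \<Rightarrow> 'b \<Rightarrow> 'a set" where
  "limiting_coderivative \<Phi> u y y' = {u'. (u', - y') \<in> limiting_normal_cone (gph \<Phi>) (u, y)}"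

definition twice_cont_diff :: "('a::real_normed_vector \<Rightarrow> real) \<Rightarrow> bool" where
  "twice_cont_diff f \<longleftrightarrow>
     (\<exists>(f' :: 'a \<Rightarrow> 'a \<Rightarrow>\<^sub>L real) (f'' :: 'a \<Rightarrow> 'a \<Rightarrow>\<^sub>L ('a \<Rightarrow>\<^sub>L real)).
        (\<forall>x. (f has_derivative blinfun_apply (f' x)) (at x)) \<and>
        (\<forall>x. (f' has_derivative blinfun_apply (f'' x)) (at x)) \<and>
        continuous_on UNIV f'')"

definition gradient :: "('a::euclidean_space \<Rightarrow> real) \<Rightarrow> 'a \<Rightarrow> 'a" where
  "gradient g x = (THE D. GDERIV g x :> D)"

definition grad_x :: "((real^'n) \<times> (real^'d) \<Rightarrow> real) \<Rightarrow> real^'n \<Rightarrow> real^'d \<Rightarrow> real^'n" where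
  "grad_x h x w = gradient (\<lambda>y. h (y, w)) x"

definition grad_w :: "((real^'n) \<times> (real^'d) \<Rightarrow> real) \<Rightarrow> real^'n \<Rightarrow> real^'d \<Rightarrow> real^'d" where
  "grad_w h x w = gradient (\<lambda>z. h (x, z)) w"

text \<open>
  Row index first: the entry at i, j is the derivative with respect to the i-th component of the
  outer variable of the j-th component of the gradient in x, whence the transposition of the
  Jacobian.
\<close>

definition hess_xx :: "((real^'n) \<times> (real^'d) \<Rightarrow> real) \<Rightarrow> real^'n \<Rightarrow> real^'d \<Rightarrow> real^'n^'n" where
  "hess_xx h x w = transpose (jacobian (\<lambda>y. grad_x h y w) (at x))"

definition hess_wx :: "((real^'n) \<times> (real^'d) \<Rightarrow> real) \<Rightarrow> real^'n \<Rightarrow> real^'d \<Rightarrow> real^'n^'d" where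
  "hess_wx h x w = transpose (jacobian (\<lambda>z. grad_x h x z) (at w))"

definition feasible_set :: "((real^'n) \<times> (real^'d) \<Rightarrow> real) \<Rightarrow> real^'d \<Rightarrow> (real^'n) set" where
  "feasible_set F w = {x. F (x, w) \<le> 0}"

definition stationary_map ::
    "((real^'n) \<times> (real^'d) \<Rightarrow> real) \<Rightarrow> ((real^'n) \<times> (real^'d) \<Rightarrow> real) \<Rightarrow> real^'d \<Rightarrow> (real^'n) set" where
  "stationary_map f0 F w =
     {x. 0 \<in> grad_x f0 x w +o limiting_normal_cone (feasible_set F w) x}"

definition normal_cone_map ::
    "((real^'n) \<times> (real^'d) \<Rightarrow> real) \<Rightarrow> (real^'n) \<times> (real^'d) \<Rightarrow> (real^'n) set" where
  "normal_cone_map F = (\<lambda>(x, w). limiting_normal_cone (feasible_set F w) x)"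

text \<open>
  The block matrix with columns H and g, as the linear map it induces on pairs;
  so no index type with n + 1 elements is needed.
\<close>

definition append_column :: "real^'n^'m \<Rightarrow> real^'m \<Rightarrow> (real^'n) \<times> real \<Rightarrow> real^'m" where
  "append_column H g = (\<lambda>(v, \<gamma>). H *v v + \<gamma> *\<^sub>R g)"

definition ker :: "('a::zero \<Rightarrow> 'b::zero) \<Rightarrow> 'a set" where
  "ker A = {v. A v = 0}"

definition A1 ::
    "((real^'n) \<times> (real^'d) \<Rightarrow> real) \<Rightarrow> ((real^'n) \<times> (real^'d) \<Rightarrow> real) \<Rightarrow> real \<Rightarrow> real^'n \<Rightarrow> real^'d \<Rightarrow>
     (real^'n) \<times> real \<Rightarrow> real^'n" where
  "A1 f0 F lam x w = append_column (hess_xx f0 x w + lam *\<^sub>R hess_xx F x w) (grad_x F x w)"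

definition A2 ::
    "((real^'n) \<times> (real^'d) \<Rightarrow> real) \<Rightarrow> ((real^'n) \<times> (real^'d) \<Rightarrow> real) \<Rightarrow> real \<Rightarrow> real^'n \<Rightarrow> real^'d \<Rightarrow>
     (real^'n) \<times> real \<Rightarrow> real^'d" where
  "A2 f0 F lam x w = append_column (hess_wx f0 x w + lam *\<^sub>R hess_wx F x w) (grad_w F x w)"

definition Gamma2 ::
    "((real^'n) \<times> (real^'d) \<Rightarrow> real) \<Rightarrow> ((real^'n) \<times> (real^'d) \<Rightarrow> real) \<Rightarrow> real \<Rightarrow> real^'n \<Rightarrow> real^'d \<Rightarrow>
     real^'n \<Rightarrow> (real^'d) set" where
  "Gamma2 f0 F lam x w x' =
     {w'. \<exists>v1 \<gamma>.
        w' = (hess_wx f0 x w + lam *\<^sub>R hess_wx F x w) *v v1 + \<gamma> *\<^sub>R grad_w F x w \<and>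
        (hess_xx f0 x w + lam *\<^sub>R hess_xx F x w) *v v1 + \<gamma> *\<^sub>R grad_x F x w = - x' \<and>
        grad_x F x w \<bullet> v1 = 0}"

definition Gamma_hat ::
    "((real^'n) \<times> (real^'d) \<Rightarrow> real) \<Rightarrow> ((real^'n) \<times> (real^'d) \<Rightarrow> real) \<Rightarrow> real^'n \<Rightarrow> real^'d \<Rightarrow>
     real^'n \<Rightarrow> (real^'d) set" where
  "Gamma_hat f0 F x w x' =
     (\<Union>v1. {w'. (- x', w') \<in>
        (hess_xx f0 x w *v v1, hess_wx f0 x w *v v1)
          +o frechet_coderivative (normal_cone_map F) (x, w) (- grad_x f0 x w) v1})"

end

theory Submission
  imports Defs
begin

text \<open>
  Near the reference point the multiplier is positive, so \<open>x \<in> S(w)\<close> means that some \<open>l > 0\<close> satisfies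
  the KKT system \<open>\<nabla>\<^sub>xf\<^sub>0 + l \<nabla>\<^sub>xF = 0\<close>, \<open>F = 0\<close>. The kernel condition says that the adjoint of the
  derivative of this system is injective; thus the system is a submersion, the solution set is a
  manifold, and a Frechet normal \<open>(w', -x')\<close> to the graph of \<open>S\<close>, extended by \<open>0\<close> in the multiplier,
  annihilates its tangent space and hence lies in the range of the adjoint, which is the linear
  system defining \<open>\<Gamma>\<^sub>2\<close>. As the adjoints stay bounded below near the reference point, this survives
  passage to limiting normals. So \<open>D*S \<subseteq> \<Gamma>\<^sub>2\<close>, and the cycle closes by
  \<open>\<Gamma>\<^sub>2 \<subseteq> \<Gamma>-hat\<close> (explicit normals to the graph of \<open>M\<close>) and \<open>\<Gamma>-hat \<subseteq> D-hat*S\<close> (chain rule for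
  \<open>(w, x) \<mapsto> (x, w, -\<nabla>\<^sub>xf\<^sub>0(x, w))\<close>).
\<close>

section \<open>Normal cones and level sets\<close>

text \<open>Multiplying by the norm turns the upper limit into an inequality that also holds at
  \<open>u = v\<close>, where both sides vanish. So the full neighbourhood filter replaces the
  punctured one, and the inequality can be composed with curves and maps that may return to
  \<open>v\<close>.\<close>

lemma frechet_normal_cone_iff:
  "v' \<in> frechet_normal_cone \<Omega> v \<longleftrightarrow>
     v \<in> \<Omega> \<and> (\<forall>e>0. \<forall>\<^sub>F u in nhds v. u \<in> \<Omega> \<longrightarrow> v' \<bullet> (u - v) \<le> e * norm (u - v))"
proof -
  have nz: "(\<forall>\<^sub>F u in nhds v. u \<in> \<Omega> \<longrightarrow> v' \<bullet> (u - v) \<le> e * norm (u - v)) \<longleftrightarrow>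
      (\<forall>\<^sub>F u in at v within \<Omega>. v' \<bullet> (u - v) \<le> e * norm (u - v))" for e
    unfolding eventually_at_filter by (intro eventually_cong[OF always_eventually]) auto
  have "Limsup (at v within \<Omega>) (\<lambda>u. ereal (v' \<bullet> (u - v) / norm (u - v))) \<le> 0 \<longleftrightarrow>
     (\<forall>e>0. \<forall>\<^sub>F u in at v within \<Omega>. v' \<bullet> (u - v) \<le> e * norm (u - v))" (is "?L \<longleftrightarrow> ?R")
  proof
    assume L: ?L
    show ?R
    proof (intro allI impI)
      fix e :: real assume "e > 0"
      then have "0 < ereal e" by simp
      with L have "\<forall>\<^sub>F u in at v within \<Omega>. ereal (v' \<bullet> (u - v) / norm (u - v)) < ereal e"
        unfolding Limsup_le_iff by blast
      moreover have "\<forall>\<^sub>F u in at v within \<Omega>. u \<noteq> v"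
        by (simp add: eventually_at_filter)
      ultimately show "\<forall>\<^sub>F u in at v within \<Omega>. v' \<bullet> (u - v) \<le> e * norm (u - v)"
        by eventually_elim (simp add: divide_less_eq)
    qed
  next
    assume R: ?R
    show ?L
      unfolding Limsup_le_iff
    proof (intro allI impI)
      fix y :: ereal assume "0 < y"
      then obtain e :: real where e: "0 < ereal e" "ereal e < y"
        using ereal_dense2 by blast
      then have "\<forall>\<^sub>F u in at v within \<Omega>. v' \<bullet> (u - v) \<le> e * norm (u - v)"
        using R by simp
      moreover have "\<forall>\<^sub>F u in at v within \<Omega>. u \<noteq> v"
        by (simp add: eventually_at_filter)
      ultimately show "\<forall>\<^sub>F u in at v within \<Omega>. ereal (v' \<bullet> (u - v) / norm (u - v)) < y"
      proof eventually_elim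
        case (elim u)
        then have "v' \<bullet> (u - v) / norm (u - v) \<le> e"
          by (simp add: divide_le_eq)
        then show ?case using e(2) by (meson ereal_less_eq(3) order_le_less_trans)
      qed
    qed
  qed
  then show ?thesis
    unfolding frechet_normal_cone_def nz by auto
qed

lemma frechet_subset_limiting_normal_cone:
  "frechet_normal_cone \<Omega> v \<subseteq> limiting_normal_cone \<Omega> v"
proof
  fix v' assume v': "v' \<in> frechet_normal_cone \<Omega> v"
  then have "v \<in> \<Omega>" by (simp add: frechet_normal_cone_iff)
  moreover have "(\<lambda>_::nat. v) \<longlonglongrightarrow> v" "(\<lambda>_::nat. v') \<longlonglongrightarrow> v'" by auto
  ultimately show "v' \<in> limiting_normal_cone \<Omega> v"
    using v' unfolding limiting_normal_cone_def by fastforce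
qed

text \<open>Dividing the normal inequality along the curve by \<open>t > 0\<close> and letting
  \<open>t\<close> tend to zero gives \<open>u \<bullet> h \<le> e * norm h\<close> for every
  \<open>e > 0\<close>. All later tests of a Frechet normal against a feasible direction go through
  this.\<close>

lemma frechet_normal_tangent:
  fixes \<zeta> :: "real \<Rightarrow> 'a::euclidean_space"
  assumes u: "u \<in> frechet_normal_cone \<Omega> v"
    and d: "(\<zeta> has_vector_derivative h) (at 0)" and v: "\<zeta> 0 = v"
    and \<Omega>: "\<forall>\<^sub>F t in at_right 0. \<zeta> t \<in> \<Omega>"
  shows "u \<bullet> h \<le> 0"
proof -
  have lim: "((\<lambda>t. (\<zeta> t - v) /\<^sub>R t) \<longlongrightarrow> h) (at_right 0)"
  proof -
    have "((\<lambda>t. (\<zeta> t - v - t *\<^sub>R h) /\<^sub>R norm t) \<longlongrightarrow> 0) (at_right 0)"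
      using has_derivative_at_withinI[OF d[unfolded has_vector_derivative_def], of "{0<..}"]
      by (simp add: has_derivative_within v divide_inverse diff_diff_eq)
    then have "((\<lambda>t. (\<zeta> t - v - t *\<^sub>R h) /\<^sub>R norm t + h) \<longlongrightarrow> 0 + h) (at_right 0)"
      by (intro tendsto_intros)
    moreover have "\<forall>\<^sub>F t in at_right 0. (\<zeta> t - v - t *\<^sub>R h) /\<^sub>R norm t + h = (\<zeta> t - v) /\<^sub>R t"
      by (auto simp: eventually_at_filter scaleR_diff_right)
    ultimately show ?thesis
      using filterlim_cong by fastforce
  qed
  have cont: "(\<zeta> \<longlongrightarrow> v) (at_right 0)"
  proof -
    have "isCont \<zeta> 0"
      using d has_derivative_continuous unfolding has_vector_derivative_def by blast
    then have "(\<zeta> \<longlongrightarrow> v) (at 0)" by (simp add: isCont_def v)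
    then show ?thesis by (rule filterlim_mono) (auto simp: at_le)
  qed
  have le: "u \<bullet> h \<le> e * norm h" if "e > 0" for e
  proof (rule tendsto_le)
    show "((\<lambda>t. u \<bullet> ((\<zeta> t - v) /\<^sub>R t)) \<longlongrightarrow> u \<bullet> h) (at_right 0)"
      "((\<lambda>t. e * norm ((\<zeta> t - v) /\<^sub>R t)) \<longlongrightarrow> e * norm h) (at_right 0)"
      by (intro tendsto_intros lim)+
    have "\<forall>\<^sub>F y in nhds v. y \<in> \<Omega> \<longrightarrow> u \<bullet> (y - v) \<le> e * norm (y - v)"
      using u that by (simp add: frechet_normal_cone_iff)
    then have "\<forall>\<^sub>F t in at_right 0. \<zeta> t \<in> \<Omega> \<longrightarrow> u \<bullet> (\<zeta> t - v) \<le> e * norm (\<zeta> t - v)"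
      using cont by (rule eventually_compose_filterlim)
    moreover have "\<forall>\<^sub>F t in at_right (0::real). t > 0"
      by (simp add: eventually_at_filter)
    ultimately show "\<forall>\<^sub>F t in at_right 0. u \<bullet> ((\<zeta> t - v) /\<^sub>R t) \<le> e * norm ((\<zeta> t - v) /\<^sub>R t)"
      using \<Omega>
      by eventually_elim (simp add: divide_simps)
  qed simp
  show ?thesis
  proof (rule ccontr)
    assume pos: "\<not> u \<bullet> h \<le> 0"
    then have "h \<noteq> 0" by auto
    \<comment> \<open>For this choice of \<open>e\<close> the bound \<open>le\<close> reads
      \<open>u \<bullet> h \<le> (u \<bullet> h) / 2\<close>.\<close>
    then show False
      using le[of "u \<bullet> h / (2 * norm h)"] pos by (simp add: field_simps)
  qed
qed

section \<open>Curves in level sets of submersions\<close>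

lemma has_derivative_small_o:
  assumes "(f has_derivative f') (at x)" "e > 0"
  shows "\<forall>\<^sub>F y in nhds x. norm (f y - f x - f' (y - x)) \<le> e * norm (y - x)"
  using assms by (simp add: has_derivative_at_alt eventually_nhds_metric dist_norm)

text \<open>In finite dimension, continuity at each basis vector is continuity in the operator norm.
  The norm version is what the inverse function theorem and the perturbation bound for adjoints work
  with.\<close>

lemma continuous_on_Blinfun:
  fixes f :: "'z::metric_space \<Rightarrow> 'a::euclidean_space \<Rightarrow> 'b::real_normed_vector"
  assumes "\<And>z. linear (f z)" "\<And>h. continuous_on UNIV (\<lambda>z. f z h)"
  shows "continuous_on UNIV (\<lambda>z. Blinfun (f z))"
proof (rule continuous_on_blinfun_componentwise)
  fix i :: 'a assume "i \<in> Basis"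
  show "continuous_on UNIV (\<lambda>z. blinfun_apply (Blinfun (f z)) i)"
    using assms by (simp add: bounded_linear_Blinfun_apply linear_linear)
qed

text \<open>Lyusternik's theorem in the form needed here: kernel vectors of a surjective derivative
  are tangent to the level set, as the inverse function theorem for a suitable chart shows.\<close>

lemma level_set_curve:
  fixes G :: "'a::euclidean_space \<Rightarrow> 'b::euclidean_space"
  assumes der: "\<And>z. (G has_derivative G' z) (at z)"
    and cont: "\<And>h. continuous_on UNIV (\<lambda>z. G' z h)"
    and surj: "surj (G' z0)" and G0: "G z0 = 0" and h: "G' z0 h = 0"
  obtains \<zeta> where "(\<zeta> has_vector_derivative h) (at 0)" "\<zeta> 0 = z0" "\<forall>\<^sub>F t in at_right (0::real). G (\<zeta> t) = 0"
proof -
  have lin: "linear (G' z)" for z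
    using der has_derivative_linear by blast
  obtain P where P: "linear P" "G' z0 \<circ> P = id"
    by (rule exE[OF linear_surjective_right_inverse[OF lin surj]]) blast
  have AP: "G' z0 (P y) = y" for y using P(2) by (metis comp_apply id_apply)
  have blP: "bounded_linear P" and blG: "bounded_linear (G' z)" for z
    using P lin by (auto simp: linear_linear)
  \<comment> \<open>\<open>\<Psi>\<close> straightens the level set: its derivative at \<open>z0\<close> is the identity, and \<open>G' z0 \<circ> \<Psi> = G\<close>
    because \<open>P\<close> is a right inverse of \<open>G' z0\<close>.\<close>
  define \<Psi> where "\<Psi> z = P (G z) + (z - P (G' z0 z))" for z
  define D where "D z k = P (G' z k) + (k - P (G' z0 k))" for z k
  have linD: "linear (D z)" for z
    by (rule linearI) (simp_all add: D_def linear_add[OF lin] linear_add[OF P(1)]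
      linear_scale[OF lin] linear_scale[OF P(1)] algebra_simps)
  have derD: "(\<Psi> has_derivative D z) (at z)" for z
    unfolding \<Psi>_def D_def
    by (intro derivative_intros bounded_linear.has_derivative[OF blP] der
         bounded_linear.has_derivative[OF blG])
  have contD: "continuous_on UNIV (\<lambda>z. Blinfun (D z))"
  proof (rule continuous_on_Blinfun[OF linD])
    show "continuous_on UNIV (\<lambda>z. D z k)" for k
      unfolding D_def by (intro continuous_intros bounded_linear.continuous_on[OF blP] cont)
  qed
  have app: "blinfun_apply (Blinfun (D z)) = D z" for z
    using linD by (simp add: bounded_linear_Blinfun_apply linear_linear)
  have D0: "D z0 = id" unfolding D_def by auto
  have id: "id_blinfun o\<^sub>L Blinfun (D z0) = id_blinfun"
    by (rule blinfun_eqI) (metis app D0 blinfun_apply_blinfun_compose blinfun_apply_id_blinfun id_apply)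
  obtain U' V g g' where U: "z0 \<in> U'" "open V" "\<Psi> z0 \<in> V" "homeomorphism U' V \<Psi> g"
    "\<And>y. y \<in> V \<Longrightarrow> (g has_derivative (g' y)) (at y)"
    "\<And>y. y \<in> V \<Longrightarrow> g' y = inv (blinfun_apply (Blinfun (D (g y))))"
    using inverse_function_theorem[OF open_UNIV _ contD _ id, of \<Psi>] derD unfolding app
    by (metis UNIV_I)
  have g0: "g (\<Psi> z0) = z0" using U homeomorphism_apply1 by metis
  have dg: "(g has_derivative id) (at (\<Psi> z0))"
    using U(5)[OF U(3)] unfolding U(6)[OF U(3)] g0 app unfolding D0 by simp
  \<comment> \<open>The inverse chart carries the straight line in direction \<open>h\<close> to the
    curve. Its derivative at \<open>\<Psi> z0\<close> is the identity, so the velocity is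
    \<open>h\<close>; along the line \<open>G' z0\<close> is constant because it annihilates
    \<open>h\<close>.\<close>
  define \<zeta> where "\<zeta> t = g (\<Psi> z0 + t *\<^sub>R h)" for t :: real
  have d1: "((\<lambda>t::real. \<Psi> z0 + t *\<^sub>R h) has_derivative (\<lambda>t. t *\<^sub>R h)) (at 0)"
    by (auto intro!: derivative_eq_intros)
  have "(g \<circ> (\<lambda>t. \<Psi> z0 + t *\<^sub>R h) has_derivative id \<circ> (\<lambda>t. t *\<^sub>R h)) (at 0)"
    by (rule diff_chain_at[OF d1]) (simp add: dg)
  then have "(\<zeta> has_vector_derivative h) (at 0)"
    by (simp add: has_vector_derivative_def o_def \<zeta>_def[abs_def])
  moreover have "\<zeta> 0 = z0" by (simp add: \<zeta>_def g0)
  moreover have "\<forall>\<^sub>F t in at_right (0::real). G (\<zeta> t) = 0"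
  proof -
    have "((\<lambda>t. \<Psi> z0 + t *\<^sub>R h) \<longlongrightarrow> \<Psi> z0 + 0 *\<^sub>R h) (at_right 0)"
      by (intro tendsto_intros)
    then have "\<forall>\<^sub>F t in at_right 0. \<Psi> z0 + t *\<^sub>R h \<in> V"
      using U(2,3) by (auto intro: topological_tendstoD)
    then show ?thesis
    proof eventually_elim
      case (elim t)
      have "\<Psi> (\<zeta> t) = \<Psi> z0 + t *\<^sub>R h"
        using U(4) elim unfolding \<zeta>_def by (metis homeomorphism_apply2)
      moreover have "G' z0 (\<Psi> z) = G z" for z
        unfolding \<Psi>_def using lin[of z0] by (simp add: linear_add linear_diff AP)
      ultimately have "G (\<zeta> t) = G' z0 (\<Psi> z0 + t *\<^sub>R h)" by metis
      also have "\<dots> = G z0 + t *\<^sub>R 0"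
        using lin[of z0] \<open>\<And>z. G' z0 (\<Psi> z) = G z\<close> h by (simp add: linear_add linear_scale)
      finally show ?case by (simp add: G0)
    qed
  qed
  ultimately show thesis by (rule that)
qed

section \<open>Ranges of adjoints and their stability under perturbation\<close>

lemma orthogonal_ker_imp_range_adjoint:
  fixes A :: "'a::euclidean_space \<Rightarrow> 'b::euclidean_space"
  assumes A: "linear A" and u: "\<And>h. A h = 0 \<Longrightarrow> u \<bullet> h = 0"
  shows "u \<in> range (adjoint A)"
proof -
  have "u \<in> (A -` {0})\<^sup>\<bottom>"
    using u by (auto simp: orthogonal_comp_def orthogonal_def inner_commute)
  also have "A -` {0} = (range (adjoint A))\<^sup>\<bottom>"
    by (rule ker_orthogonal_comp_adjoint[OF A])
  also have "\<dots>\<^sup>\<bottom> = range (adjoint A)"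
    by (intro orthogonal_comp_self linear_subspace_image adjoint_linear[OF A] subspace_UNIV)
  finally show ?thesis .
qed

text \<open>The coordinates of \<open>adjoint (A z) y\<close> are inner products of \<open>y\<close>
  with values of \<open>A z\<close>, hence continuous in \<open>z\<close>. Continuity in the
  operator norm then makes the estimate uniform in \<open>y\<close>.\<close>

lemma adjoint_perturbation:
  fixes A :: "'z::metric_space \<Rightarrow> 'a::euclidean_space \<Rightarrow> 'b::euclidean_space"
  assumes lin: "\<And>z. linear (A z)" and cont: "\<And>h. continuous_on UNIV (\<lambda>z. A z h)"
    and e: "e > 0"
  shows "\<forall>\<^sub>F z in nhds z0. \<forall>y. norm (adjoint (A z) y - adjoint (A z0) y) \<le> e * norm y"
proof -
  have ladj: "linear (adjoint (A z))" for z by (rule adjoint_linear[OF lin])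
  have "continuous_on UNIV (\<lambda>z. adjoint (A z) y)" for y
  proof (rule continuous_on_componentwise[THEN iffD2], intro ballI)
    fix i :: 'a
    show "continuous_on UNIV (\<lambda>z. adjoint (A z) y \<bullet> i)"
      unfolding adjoint_clauses(2)[OF lin] by (intro continuous_intros cont)
  qed
  then have "continuous_on UNIV (\<lambda>z. Blinfun (adjoint (A z)))"
    by (intro continuous_on_Blinfun ladj)
  then have "\<forall>\<^sub>F z in nhds z0. dist (Blinfun (adjoint (A z))) (Blinfun (adjoint (A z0))) < e"
    using e by (intro tendstoD tendsto_at_iff_tendsto_nhds[THEN iffD1])
      (auto simp: continuous_on_def)
  then show ?thesis
  proof eventually_elim
    case (elim z)
    show ?case
    proof
      fix y
      let ?E = "Blinfun (adjoint (A z)) - Blinfun (adjoint (A z0))"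
      have "norm (adjoint (A z) y - adjoint (A z0) y) = norm (blinfun_apply ?E y)"
        using ladj by (simp add: bounded_linear_Blinfun_apply linear_linear blinfun.diff_left)
      also have "\<dots> \<le> norm ?E * norm y" by (rule norm_blinfun)
      also have "\<dots> \<le> e * norm y"
        using elim by (intro mult_right_mono) (simp_all add: dist_norm)
      finally show "norm (adjoint (A z) y - adjoint (A z0) y) \<le> e * norm y" .
    qed
  qed
qed

text \<open>Surjectivity means that the adjoint is injective, hence bounded below by some
  \<open>B\<close> at \<open>z0\<close>. A perturbation of size \<open>B/2\<close> leaves the lower
  bound \<open>B/2\<close>, which serves as one constant for all nearby \<open>z\<close>.\<close>

lemma eventually_surj:
  fixes A :: "'z::metric_space \<Rightarrow> 'a::euclidean_space \<Rightarrow> 'b::euclidean_space"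
  assumes lin: "\<And>z. linear (A z)" and cont: "\<And>h. continuous_on UNIV (\<lambda>z. A z h)"
    and surj: "surj (A z0)"
  obtains c where "c > 0" "\<forall>\<^sub>F z in nhds z0. surj (A z) \<and> (\<forall>y. c * norm y \<le> norm (adjoint (A z) y))"
proof -
  have inj: "inj (adjoint (A z)) \<longleftrightarrow> surj (A z)" for z by (rule inj_adjoint_iff_surj[OF lin])
  obtain B where B: "B > 0" "\<And>y. B * norm y \<le> norm (adjoint (A z0) y)"
    using linear_inj_bounded_below_pos[OF adjoint_linear[OF lin, of z0]] surj by (auto simp: inj)
  have "\<forall>\<^sub>F z in nhds z0. \<forall>y. norm (adjoint (A z) y - adjoint (A z0) y) \<le> (B/2) * norm y"
    by (rule adjoint_perturbation) (use lin cont B in auto)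
  then have "\<forall>\<^sub>F z in nhds z0. surj (A z) \<and> (\<forall>y. (B/2) * norm y \<le> norm (adjoint (A z) y))"
  proof eventually_elim
    case (elim z)
    have le: "(B/2) * norm y \<le> norm (adjoint (A z) y)" for y
    proof -
      have "norm (adjoint (A z0) y) \<le> norm (adjoint (A z) y) + norm (adjoint (A z) y - adjoint (A z0) y)"
        by (metis norm_minus_commute norm_triangle_sub)
      then show ?thesis using elim[rule_format, of y] B(2)[of y] by simp
    qed
    have "inj (adjoint (A z))"
    proof (rule linear_injective_0[THEN iffD2, OF adjoint_linear[OF lin]], intro allI impI)
      fix y assume "adjoint (A z) y = 0"
      then show "y = 0" using le[of y] B(1) by (simp add: mult_le_0_iff)
    qed
    then show ?case using le inj by blast
  qed
  then show thesis using B(1) that[of "B/2"] by simp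
qed

text \<open>The uniform lower bound keeps the preimages \<open>y k\<close> of \<open>U k\<close>
  bounded, so replacing \<open>A (Z k)\<close> by \<open>A z0\<close> changes \<open>U k\<close> by
  a vanishing amount. Thus \<open>u\<close> is a limit of points in the range of one fixed adjoint,
  and that range is closed.\<close>

lemma range_adjoint_limit:
  fixes A :: "'z::metric_space \<Rightarrow> 'a::euclidean_space \<Rightarrow> 'b::euclidean_space"
  assumes lin: "\<And>z. linear (A z)" and cont: "\<And>h. continuous_on UNIV (\<lambda>z. A z h)"
    and surj: "surj (A z0)" and Z: "Z \<longlonglongrightarrow> z0" and U: "U \<longlonglongrightarrow> u"
    and mem: "\<forall>\<^sub>F k in sequentially. U k \<in> range (adjoint (A (Z k)))"
  shows "u \<in> range (adjoint (A z0))"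
proof -
  obtain c where c: "c > 0"
    "\<forall>\<^sub>F z in nhds z0. surj (A z) \<and> (\<forall>y. c * norm y \<le> norm (adjoint (A z) y))"
    by (rule eventually_surj[where A = A and ?z0.0 = z0, OF lin cont surj])
  define y where "y k = (SOME y. U k = adjoint (A (Z k)) y)" for k
  have y: "\<forall>\<^sub>F k in sequentially. U k = adjoint (A (Z k)) (y k)"
    using mem
  proof eventually_elim
    case (elim k)
    then have "\<exists>y. U k = adjoint (A (Z k)) y" by (simp add: image_iff)
    then show ?case unfolding y_def by (rule someI_ex)
  qed
  have lb: "\<forall>\<^sub>F k in sequentially. c * norm (y k) \<le> norm (U k)"
    using eventually_compose_filterlim[OF c(2) Z] y by eventually_elim auto
  have "\<forall>\<^sub>F k in sequentially. norm (U k) < norm u + 1"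
    using tendsto_norm[OF U] by (rule order_tendstoD) simp
  with lb have bd: "\<forall>\<^sub>F k in sequentially. norm (y k) \<le> (norm u + 1) / c"
    by eventually_elim (use c(1) in \<open>simp add: field_simps\<close>)
  have "(\<lambda>k. adjoint (A z0) (y k) - U k) \<longlonglongrightarrow> 0"
  proof (rule tendstoI)
    fix e :: real assume e: "e > 0"
    \<comment> \<open>\<open>K\<close> eventually bounds the preimages \<open>y k\<close>, so the
      tolerance \<open>e / (2*K)\<close> produces an error of at most \<open>e/2\<close>.\<close>
    define K where "K = (norm u + 1) / c"
    have K: "K > 0" using c(1) by (simp add: K_def add_nonneg_pos)
    have "\<forall>\<^sub>F z in nhds z0. \<forall>y. norm (adjoint (A z) y - adjoint (A z0) y) \<le> (e / (2*K)) * norm y"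
      by (rule adjoint_perturbation) (use lin cont e K in auto)
    from eventually_compose_filterlim[OF this Z] bd y
    show "\<forall>\<^sub>F k in sequentially. dist (adjoint (A z0) (y k) - U k) 0 < e"
    proof eventually_elim
      case (elim k)
      have "norm (adjoint (A z0) (y k) - U k) \<le> (e / (2*K)) * norm (y k)"
        using elim by (metis norm_minus_commute)
      also have "\<dots> \<le> (e / (2*K)) * K"
        using elim(2)[folded K_def] e K by (intro mult_left_mono) auto
      also have "\<dots> < e" using e K by simp
      finally show ?case by simp
    qed
  qed
  from tendsto_add[OF this U] have lim: "(\<lambda>k. adjoint (A z0) (y k)) \<longlonglongrightarrow> u" by simp
  have "closed (range (adjoint (A z0)))"
    by (intro closed_subspace linear_subspace_image adjoint_linear[OF lin] subspace_UNIV)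
  then show ?thesis 
    by (rule closed_sequentially[OF _ rangeI[of "adjoint (A z0)"] lim])
qed

section \<open>Partial gradients and Hessians\<close>

lemma gradient_eqI:
  assumes "(g has_derivative (\<lambda>h. D \<bullet> h)) (at x)"
  shows "gradient g x = D"
  unfolding gradient_def
proof (rule the_equality)
  show "GDERIV g x :> D"
    using assms by (simp add: gderiv_def inner_commute)
  fix D' assume "GDERIV g x :> D'"
  then have "(g has_derivative (\<lambda>h. D' \<bullet> h)) (at x)"
    by (simp add: gderiv_def inner_commute)
  from has_derivative_unique[OF this assms] show "D' = D"
    by (metis vector_eq_rdot)
qed

lemma linear_functional_inner:
  fixes L :: "'a::euclidean_space \<Rightarrow> real"
  assumes "linear L"
  obtains D where "L = (\<lambda>h. D \<bullet> h)"
proof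
  show "L = (\<lambda>h. adjoint L 1 \<bullet> h)"
    by (simp add: adjoint_clauses[OF assms])
qed

lemma has_derivative_partial:
  assumes "(h has_derivative D) (at (x, w))"
  shows "((\<lambda>y. h (y, w)) has_derivative (\<lambda>k. D (k, 0))) (at x)"
    and "((\<lambda>z. h (x, z)) has_derivative (\<lambda>k. D (0, k))) (at w)"
proof -
  have "((\<lambda>y. (y, w)) has_derivative (\<lambda>k. (k, 0))) (at x)"
    "((\<lambda>z. (x, z)) has_derivative (\<lambda>k. (0, k))) (at w)"
    by (auto intro!: derivative_eq_intros)
  from this[THEN diff_chain_at, of h D] assms
  show "((\<lambda>y. h (y, w)) has_derivative (\<lambda>k. D (k, 0))) (at x)"
    "((\<lambda>z. h (x, z)) has_derivative (\<lambda>k. D (0, k))) (at w)"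
    by (simp_all add: o_def)
qed

lemma inner_transpose_jacobian:
  fixes g :: "real^'m \<Rightarrow> real^'n"
  assumes "(g has_derivative D) (at x)"
  shows "(transpose (jacobian g (at x)) *v v) \<bullet> k = v \<bullet> D k"
proof -
  have "(g has_derivative (\<lambda>h. jacobian g (at x) *v h)) (at x)"
    using assms jacobian_works differentiable_def by blast
  then have "D = (\<lambda>h. jacobian g (at x) *v h)"
    using assms has_derivative_unique by blast
  then show ?thesis
    by (simp add: dot_lmul_matrix)
qed

text \<open>The derivative is taken jointly in both variables, because the graphs studied below let
  \<open>x\<close> and \<open>w\<close> move together; \<open>inner_dgrad_x\<close> recovers the two
  Hessian blocks.\<close>

definition dgrad_x ::
    "((real^'n) \<times> (real^'d) \<Rightarrow> real) \<Rightarrow> (real^'n) \<times> (real^'d) \<Rightarrow> (real^'n) \<times> (real^'d) \<Rightarrow> real^'n" where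
  "dgrad_x h z = frechet_derivative (\<lambda>(x, w). grad_x h x w) (at z)"

context
  fixes h :: "(real^'n) \<times> (real^'d) \<Rightarrow> real"
  assumes h: "twice_cont_diff h"
begin

lemma has_derivative_grad:
  "(h has_derivative (\<lambda>k. grad_x h (fst z) (snd z) \<bullet> fst k + grad_w h (fst z) (snd z) \<bullet> snd k)) (at z)"
proof -
  obtain x w where z: "z = (x, w)" by fastforce
  obtain D where D: "(h has_derivative D) (at z)"
    using h unfolding twice_cont_diff_def by blast
  then have lin: "linear D" by (rule has_derivative_linear)
  note p = has_derivative_partial[OF D[unfolded z]]
  note lp = p[THEN has_derivative_linear]
  obtain gx gw where g: "(\<lambda>k. D (k, 0)) = (\<lambda>k. gx \<bullet> k)" "(\<lambda>k. D (0, k)) = (\<lambda>k. gw \<bullet> k)"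
    using lp linear_functional_inner by metis
  have "gx = grad_x h x w" "gw = grad_w h x w"
    using p gradient_eqI unfolding g grad_x_def grad_w_def by metis+
  then have "D (k, 0) = grad_x h x w \<bullet> k" "D (0, l) = grad_w h x w \<bullet> l" for k l
    using g by metis+
  moreover have "D k = D (fst k, 0) + D (0, snd k)" for k
    by (simp flip: linear_add[OF lin])
  ultimately have "D k = grad_x h (fst z) (snd z) \<bullet> fst k + grad_w h (fst z) (snd z) \<bullet> snd k" for k
    unfolding z fst_conv snd_conv by metis
  then have "D = (\<lambda>k. grad_x h (fst z) (snd z) \<bullet> fst k + grad_w h (fst z) (snd z) \<bullet> snd k)"
    by (rule ext)
  then show ?thesis using D by simp
qed

text \<open>Both partial gradients arise from the full derivative \<open>f'\<close> by evaluation at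
  \<open>(b, 0)\<close> or \<open>(0, b)\<close> for basis vectors \<open>b\<close>. This is bounded
  linear in \<open>f'\<close>, so differentiability and continuity carry over from \<open>f'\<close>
  and \<open>f''\<close>.\<close>

lemma has_derivative_grad_x:
  "((\<lambda>(x, w). grad_x h x w) has_derivative dgrad_x h z) (at z)" (is ?der)
  and continuous_dgrad_x: "continuous_on UNIV (\<lambda>z. dgrad_x h z k)" (is ?cont)
  and continuous_grad_w: "continuous_on UNIV (\<lambda>(x, w). grad_w h x w)" (is ?contw)
proof -
  obtain f' :: "_ \<Rightarrow> _ \<Rightarrow>\<^sub>L real" and f'' where
    f': "\<And>x. (h has_derivative blinfun_apply (f' x)) (at x)" and
    f'': "\<And>x. (f' has_derivative blinfun_apply (f'' x)) (at x)" and
    c: "continuous_on UNIV f''"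
    using h unfolding twice_cont_diff_def by blast
  have eq: "blinfun_apply (f' z) = (\<lambda>k. grad_x h (fst z) (snd z) \<bullet> fst k + grad_w h (fst z) (snd z) \<bullet> snd k)" for z
    using f' has_derivative_grad has_derivative_unique by blast
  have gx: "(\<lambda>(x, w). grad_x h x w) = (\<lambda>z. \<Sum>b\<in>Basis. blinfun_apply (f' z) (b, 0) *\<^sub>R b)"
    unfolding eq by (auto simp: euclidean_representation)
  have gw: "(\<lambda>(x, w). grad_w h x w) = (\<lambda>z. \<Sum>b\<in>Basis. blinfun_apply (f' z) (0, b) *\<^sub>R b)"
    unfolding eq by (auto simp: euclidean_representation)
  have d: "((\<lambda>(x, w). grad_x h x w) has_derivative
      (\<lambda>k. \<Sum>b\<in>Basis. blinfun_apply (blinfun_apply (f'' z) k) (b, 0) *\<^sub>R b)) (at z)" for z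
    unfolding gx
    by (auto intro!: derivative_eq_intros f'')
  then have deq: "dgrad_x h z = (\<lambda>k. \<Sum>b\<in>Basis. blinfun_apply (blinfun_apply (f'' z) k) (b, 0) *\<^sub>R b)" for z
    unfolding dgrad_x_def by (rule frechet_derivative_at[symmetric])
  show ?der using d unfolding deq .
  show ?cont unfolding deq by (intro continuous_intros c)
  have "continuous_on UNIV f'"
    by (meson f'' has_derivative_continuous continuous_at_imp_continuous_on)
  then show ?contw unfolding gw by (intro continuous_intros)
qed

lemma continuous_grad_x: "continuous_on UNIV (\<lambda>(x, w). grad_x h x w)"
proof (rule continuous_at_imp_continuous_on, rule ballI)
  show "isCont (\<lambda>(x, w). grad_x h x w) z" for z
    by (rule has_derivative_continuous) (rule has_derivative_grad_x)
qed

text \<open>The transpositions in \<open>hess_xx\<close> and \<open>hess_wx\<close> turn the partial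
  Jacobians into the two blocks of the adjoint of \<open>dgrad_x\<close>.\<close>

lemma inner_dgrad_x:
  "v \<bullet> dgrad_x h (x, w) k = (hess_xx h x w *v v) \<bullet> fst k + (hess_wx h x w *v v) \<bullet> snd k"
proof -
  note D = has_derivative_grad_x[of "(x, w)"]
  note p = has_derivative_partial[OF D, simplified]
  have "dgrad_x h (x, w) k = dgrad_x h (x, w) (fst k, 0) + dgrad_x h (x, w) (0, snd k)"
    by (simp flip: linear_add[OF has_derivative_linear[OF D]])
  then show ?thesis
    unfolding hess_xx_def hess_wx_def inner_transpose_jacobian[OF p(1)] inner_transpose_jacobian[OF p(2)]
    by (simp add: inner_add_right)
qed

end

section \<open>Normals to sublevel sets\<close>

text \<open>By continuity \<open>x + t *\<^sub>R v\<close> stays in the set for small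
  \<open>t > 0\<close>, so \<open>v\<close> can be tested against itself.\<close>

lemma frechet_normal_sublevel_interior:
  fixes \<phi> :: "'a::euclidean_space \<Rightarrow> real"
  assumes cont: "isCont \<phi> x" and neg: "\<phi> x < 0" and v: "v \<in> frechet_normal_cone {x. \<phi> x \<le> 0} x"
  shows "v = 0"
proof -
  have "((\<lambda>t::real. x + t *\<^sub>R v) \<longlongrightarrow> x + 0 *\<^sub>R v) (at_right 0)"
    by (intro tendsto_intros)
  then have "((\<lambda>t. \<phi> (x + t *\<^sub>R v)) \<longlongrightarrow> \<phi> x) (at_right 0)"
    using cont by (auto intro: isCont_tendsto_compose)
  then have "\<forall>\<^sub>F t in at_right 0. \<phi> (x + t *\<^sub>R v) < 0"
    using neg by (rule order_tendstoD)
  then have "\<forall>\<^sub>F t in at_right 0. x + t *\<^sub>R v \<in> {x. \<phi> x \<le> 0}"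
    by eventually_elim simp
  moreover have "((\<lambda>t. x + t *\<^sub>R v) has_vector_derivative v) (at 0)"
    by (auto intro!: derivative_eq_intros simp: has_vector_derivative_def)
  ultimately have "v \<bullet> v \<le> 0"
    using frechet_normal_tangent[OF v, of "\<lambda>t. x + t *\<^sub>R v" v] by simp
  then show ?thesis by (metis inner_eq_zero_iff inner_ge_zero order_antisym)
qed

text \<open>Every strict descent direction of \<open>\<phi>\<close> is feasible, so \<open>v\<close>
  makes no acute angle with it. This forces the component \<open>r\<close> of \<open>v\<close>
  orthogonal to \<open>g\<close> to vanish.\<close>

lemma frechet_normal_sublevel:
  fixes \<phi> :: "'a::euclidean_space \<Rightarrow> real"
  assumes der: "(\<phi> has_derivative (\<lambda>k. g \<bullet> k)) (at x)" and g: "g \<noteq> 0"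
    and v: "v \<in> frechet_normal_cone {x. \<phi> x \<le> 0} x"
  shows "v = (v \<bullet> g / (g \<bullet> g)) *\<^sub>R g"
proof -
  have x: "\<phi> x \<le> 0" using v by (simp add: frechet_normal_cone_iff)
  have desc: "v \<bullet> d \<le> 0" if d: "g \<bullet> d < 0" for d
  proof (rule frechet_normal_tangent[OF v])
    show c: "((\<lambda>t. x + t *\<^sub>R d) has_vector_derivative d) (at 0)"
      by (auto intro!: derivative_eq_intros simp: has_vector_derivative_def)
    show "x + 0 *\<^sub>R d = x" by simp
    have "((\<phi> \<circ> (\<lambda>t. x + t *\<^sub>R d)) has_derivative (\<lambda>k. g \<bullet> k) \<circ> (\<lambda>t. t *\<^sub>R d)) (at 0)"
      using c by (intro diff_chain_at) (simp_all add: has_vector_derivative_def der)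
    moreover have "(\<lambda>k. g \<bullet> k) \<circ> (\<lambda>t. t *\<^sub>R d) = (*) (g \<bullet> d)" by (auto simp: o_def)
    ultimately have "DERIV (\<phi> \<circ> (\<lambda>t. x + t *\<^sub>R d)) 0 :> g \<bullet> d"
      by (simp add: has_field_derivative_def)
    from DERIV_neg_dec_right[OF this d] obtain e where e: "e > 0"
      "\<And>t. t > 0 \<Longrightarrow> t < e \<Longrightarrow> \<phi> (x + t *\<^sub>R d) < \<phi> x" by auto
    show "\<forall>\<^sub>F t in at_right 0. x + t *\<^sub>R d \<in> {x. \<phi> x \<le> 0}"
      unfolding eventually_at_right_field
      using e x by (intro exI[of _ e]) (auto intro: less_imp_le less_le_trans)
  qed
  have gg: "g \<bullet> g > 0" using g by simp
  have nn: "0 \<le> v \<bullet> g" using desc[of "- g"] gg by simp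
  define r where "r = v - (v \<bullet> g / (g \<bullet> g)) *\<^sub>R g"
  have rg: "r \<bullet> g = 0" using g by (simp add: r_def inner_diff_left)
  have vr: "v \<bullet> r = r \<bullet> r"
    using rg by (simp add: r_def inner_diff_left inner_commute)
  have "r \<bullet> r \<le> e" if "e > 0" for e
  proof -
    \<comment> \<open>\<open>r\<close> is only orthogonal to \<open>g\<close>; subtracting
      \<open>s *\<^sub>R g\<close> makes it a strict descent direction. The choice of
      \<open>s\<close> gives \<open>s * (v \<bullet> g) \<le> e\<close>, and the \<open>1\<close>
      keeps the denominator positive.\<close>
    define s where "s = e / (v \<bullet> g + 1)"
    have s: "s > 0" using that nn by (simp add: s_def)
    have "v \<bullet> (r - s *\<^sub>R g) \<le> 0"
      by (rule desc) (use rg gg s in \<open>simp add: inner_diff_right inner_commute\<close>)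
    then have "r \<bullet> r \<le> s * (v \<bullet> g)" by (simp add: inner_diff_right vr)
    also have "\<dots> \<le> s * (v \<bullet> g + 1)" using s by (intro mult_left_mono) auto
    also have "\<dots> = e" using nn by (simp add: s_def)
    finally show ?thesis .
  qed
  then have "r \<bullet> r \<le> 0" by (rule field_le_epsilon[of _ 0, simplified])
  then have "r = 0" by (metis inner_eq_zero_iff inner_ge_zero order_antisym)
  then show "v = (v \<bullet> g / (g \<bullet> g)) *\<^sub>R g" by (simp add: r_def)
qed

text \<open>Since \<open>\<phi> y \<le> 0 = \<phi> x\<close> on the set, the linear part of
  \<open>\<phi>\<close> is at most the remainder of the expansion. The tolerance
  \<open>e / (m + 1)\<close> absorbs the factor \<open>m\<close>, including
  \<open>m = 0\<close>.\<close>

lemma sublevel_gradient_frechet_normal: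
  fixes \<phi> :: "'a::euclidean_space \<Rightarrow> real"
  assumes der: "(\<phi> has_derivative (\<lambda>k. g \<bullet> k)) (at x)" and x: "\<phi> x = 0" and m: "m \<ge> 0"
  shows "m *\<^sub>R g \<in> frechet_normal_cone {x. \<phi> x \<le> 0} x"
  unfolding frechet_normal_cone_iff
proof (intro conjI allI impI)
  show "x \<in> {x. \<phi> x \<le> 0}" using x by simp
  fix e :: real assume e: "e > 0"
  have "\<forall>\<^sub>F y in nhds x. norm (\<phi> y - \<phi> x - g \<bullet> (y - x)) \<le> (e / (m + 1)) * norm (y - x)"
    by (rule has_derivative_small_o[OF der]) (use e m in simp)
  then show "\<forall>\<^sub>F y in nhds x. y \<in> {x. \<phi> x \<le> 0} \<longrightarrow> (m *\<^sub>R g) \<bullet> (y - x) \<le> e * norm (y - x)"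
  proof eventually_elim
    case (elim y)
    show ?case
    proof
      assume "y \<in> {x. \<phi> x \<le> 0}"
      then have "g \<bullet> (y - x) \<le> (e / (m + 1)) * norm (y - x)"
        using elim x by (auto simp: abs_le_iff)
      then have "m * (g \<bullet> (y - x)) \<le> m * ((e / (m + 1)) * norm (y - x))"
        using m by (rule mult_left_mono)
      also have "\<dots> = (m / (m + 1)) * (e * norm (y - x))" by simp
      also have "\<dots> \<le> 1 * (e * norm (y - x))"
        using m e by (intro mult_right_mono) auto
      finally show "(m *\<^sub>R g) \<bullet> (y - x) \<le> e * norm (y - x)" by simp
    qed
  qed
qed

text \<open>A nonzero limit forces the approximating normals to be nonzero eventually, hence their
  base points to satisfy \<open>\<phi> = 0\<close>. The projection coefficient is an explicit
  quotient, continuous where \<open>g\<close> is nonzero, so the formula passes to the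
  limit.\<close>

lemma limiting_normal_sublevel:
  fixes \<phi> :: "'a::euclidean_space \<Rightarrow> real"
  assumes der: "\<And>x. (\<phi> has_derivative (\<lambda>k. g x \<bullet> k)) (at x)" and cont: "isCont g x" and g: "g x \<noteq> 0"
    and v: "v \<in> limiting_normal_cone {x. \<phi> x \<le> 0} x" and v0: "v \<noteq> 0"
  shows "\<phi> x = 0" "v = (v \<bullet> g x / (g x \<bullet> g x)) *\<^sub>R g x"
proof -
  obtain V V' where V: "V \<longlonglongrightarrow> x" "V' \<longlonglongrightarrow> v"
    and n: "\<And>k. V' k \<in> frechet_normal_cone {x. \<phi> x \<le> 0} (V k)"
    using v unfolding limiting_normal_cone_def by (auto split: if_splits)
  have c\<phi>: "isCont \<phi> y" for y by (rule has_derivative_continuous[OF der])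
  have "\<forall>\<^sub>F k in sequentially. V' k \<noteq> 0"
    using V(2) v0 by (rule tendsto_imp_eventually_ne)
  then have "\<forall>\<^sub>F k in sequentially. \<phi> (V k) = 0"
  proof eventually_elim
    case (elim k)
    have "\<phi> (V k) \<le> 0" using n[of k] by (simp add: frechet_normal_cone_iff)
    moreover have "\<not> \<phi> (V k) < 0"
      using frechet_normal_sublevel_interior[OF c\<phi> _ n] elim by blast
    ultimately show ?case by simp
  qed
  then have "(\<lambda>k. \<phi> (V k)) \<longlonglongrightarrow> 0" by (rule tendsto_eventually)
  moreover have "(\<lambda>k. \<phi> (V k)) \<longlonglongrightarrow> \<phi> x"
    using c\<phi> V(1) by (rule isCont_tendsto_compose)
  ultimately show "\<phi> x = 0" by (rule LIMSEQ_unique[symmetric])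
  have gl: "(\<lambda>k. g (V k)) \<longlonglongrightarrow> g x" using cont V(1) by (rule isCont_tendsto_compose)
  then have ne: "\<forall>\<^sub>F k in sequentially. g (V k) \<noteq> 0" using g by (rule tendsto_imp_eventually_ne)
  show "v = (v \<bullet> g x / (g x \<bullet> g x)) *\<^sub>R g x"
  proof (rule LIMSEQ_unique[OF V(2)])
    have "(\<lambda>k. (V' k \<bullet> g (V k) / (g (V k) \<bullet> g (V k))) *\<^sub>R g (V k)) \<longlonglongrightarrow> (v \<bullet> g x / (g x \<bullet> g x)) *\<^sub>R g x"
      by (intro tendsto_intros gl V) (use g in simp)
    moreover have "\<forall>\<^sub>F k in sequentially. (V' k \<bullet> g (V k) / (g (V k) \<bullet> g (V k))) *\<^sub>R g (V k) = V' k"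
      using ne by eventually_elim (rule frechet_normal_sublevel[OF der _ n, symmetric])
    ultimately show "V' \<longlonglongrightarrow> (v \<bullet> g x / (g x \<bullet> g x)) *\<^sub>R g x"
      using Lim_transform_eventually by blast
  qed
qed

section \<open>Frechet normals by pullback and from vanishing functions\<close>

lemma frechet_normal_cone_preimage:
  fixes f :: "'a::euclidean_space \<Rightarrow> 'b::euclidean_space"
  assumes der: "(f has_derivative f') (at v)" and v: "v \<in> \<Omega>" and img: "f ` \<Omega> \<subseteq> \<Theta>"
    and n: "n \<in> frechet_normal_cone \<Theta> (f v)" and u: "\<And>k. u \<bullet> k = n \<bullet> f' k"
  shows "u \<in> frechet_normal_cone \<Omega> v"
  unfolding frechet_normal_cone_iff
proof (intro conjI v allI impI)
  fix e :: real assume e: "e > 0"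
  obtain K where K: "K > 0" "\<And>k. norm (f' k) \<le> K * norm k"
    using bounded_linear.pos_bounded[OF has_derivative_bounded_linear[OF der]] by (metis mult.commute)
  \<comment> \<open>The error budget \<open>e\<close> is split in half. Near \<open>v\<close> the
    increment of \<open>f\<close> is at most \<open>(K + 1) * norm (y - v)\<close>, which
    \<open>a\<close> compensates; \<open>b\<close> is at most \<open>1\<close> to secure that growth
    bound, and small enough that \<open>n\<close> applied to the remainder costs at most the other
    half.\<close>
  define a where "a = (e / 2) / (K + 1)"
  define b where "b = min 1 (e / (2 * (norm n + 1)))"
  have aK: "a * (K + 1) = e / 2" using K(1) by (intro nonzero_eq_divide_eq[THEN iffD1, OF _ a_def]) simp
  have a: "a > 0" using K e by (simp add: a_def)
  have b: "b > 0" using e by (simp add: b_def add_nonneg_pos)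
  have "isCont f v" by (rule has_derivative_continuous[OF der])
  then have "(f \<longlongrightarrow> f v) (nhds v)" by (simp add: isCont_def tendsto_at_iff_tendsto_nhds)
  moreover have "\<forall>\<^sub>F y in nhds (f v). y \<in> \<Theta> \<longrightarrow> n \<bullet> (y - f v) \<le> a * norm (y - f v)"
    using n a by (simp add: frechet_normal_cone_iff)
  ultimately have "\<forall>\<^sub>F y in nhds v. f y \<in> \<Theta> \<longrightarrow> n \<bullet> (f y - f v) \<le> a * norm (f y - f v)"
    by (rule eventually_compose_filterlim[rotated])
  then show "\<forall>\<^sub>F y in nhds v. y \<in> \<Omega> \<longrightarrow> u \<bullet> (y - v) \<le> e * norm (y - v)"
    using has_derivative_small_o[OF der b]
  proof eventually_elim
    case (elim y)
    show ?case
    proof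
      assume "y \<in> \<Omega>"
      then have 1: "n \<bullet> (f y - f v) \<le> a * norm (f y - f v)" using elim(1) img by blast
      let ?d = "norm (y - v)" and ?R = "f y - f v - f' (y - v)"
      have R: "norm ?R \<le> b * ?d" by (rule elim(2))
      also have "\<dots> \<le> 1 * ?d" by (intro mult_right_mono) (auto simp: b_def)
      finally have R1: "norm ?R \<le> ?d" by simp
      have "norm (f y - f v) \<le> norm (f' (y - v)) + norm ?R"
        by (metis add.commute diff_add_cancel norm_triangle_ineq)
      also have "\<dots> \<le> (K + 1) * ?d" using K(2)[of "y - v"] R1 by (simp add: algebra_simps)
      finally have 2: "a * norm (f y - f v) \<le> a * ((K + 1) * ?d)" using a by simp
      have "norm n * norm ?R \<le> norm n * ((e / (2 * (norm n + 1))) * ?d)"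
      proof (rule mult_left_mono)
        show "norm ?R \<le> (e / (2 * (norm n + 1))) * ?d"
          by (rule order_trans[OF R]) (intro mult_right_mono, auto simp: b_def)
      qed simp
      also have "\<dots> = (norm n / (norm n + 1)) * (e / 2 * ?d)"
        by (simp add: field_simps)
      also have "\<dots> \<le> 1 * (e / 2 * ?d)"
        using e by (intro mult_right_mono) (auto simp: divide_le_eq add_nonneg_pos)
      finally have 3: "norm n * norm ?R \<le> e / 2 * ?d" by simp
      have "u \<bullet> (y - v) = n \<bullet> (f y - f v) - n \<bullet> ?R" unfolding u by (simp add: inner_diff_right)
      also have "\<dots> \<le> a * ((K + 1) * ?d) + e / 2 * ?d"
        using 1 2 3 Cauchy_Schwarz_ineq2[of n ?R] by linarith
      also have "a * ((K + 1) * ?d) = e / 2 * ?d" by (simp only: mult.assoc[symmetric] aK)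
      finally show "u \<bullet> (y - v) \<le> e * ?d" by simp
    qed
  qed
qed

text \<open>On the set the expansion of \<open>\<psi>\<close> consists of its linear part and the
  remainder only, so the linear part is itself of smaller order.\<close>

lemma frechet_normal_of_vanishing:
  fixes \<psi> :: "'a::euclidean_space \<Rightarrow> real"
  assumes der: "(\<psi> has_derivative (\<lambda>k. u \<bullet> k)) (at v)" and v: "v \<in> \<Omega>" "\<psi> v = 0"
    and z: "\<forall>\<^sub>F y in nhds v. y \<in> \<Omega> \<longrightarrow> \<psi> y = 0"
  shows "u \<in> frechet_normal_cone \<Omega> v"
  unfolding frechet_normal_cone_iff
proof (intro conjI v allI impI)
  fix e :: real assume e: "e > 0"
  from has_derivative_small_o[OF der e] z
  show "\<forall>\<^sub>F y in nhds v. y \<in> \<Omega> \<longrightarrow> u \<bullet> (y - v) \<le> e * norm (y - v)"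
    by eventually_elim (auto simp: v(2))
qed

section \<open>The normal cone map\<close>

context
  fixes F :: "(real^'n) \<times> (real^'d) \<Rightarrow> real"
  assumes F: "twice_cont_diff F"
begin

lemma has_derivative_in_x: "((\<lambda>y. F (y, w)) has_derivative (\<lambda>k. grad_x F x w \<bullet> k)) (at x)"
  using has_derivative_partial(1)[OF has_derivative_grad[OF F, of "(x, w)"]] by simp

lemma normal_cone_mapD:
  assumes v: "v \<in> normal_cone_map F (x, w)" "v \<noteq> 0" and g: "grad_x F x w \<noteq> 0"
  shows "F (x, w) = 0" "v = (v \<bullet> grad_x F x w / (grad_x F x w \<bullet> grad_x F x w)) *\<^sub>R grad_x F x w"
proof -
  have c: "isCont (\<lambda>y. grad_x F y w) x"
    using has_derivative_partial(1)[OF has_derivative_grad_x[OF F, of "(x, w)"]]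
    by (auto dest: has_derivative_continuous)
  have v': "v \<in> limiting_normal_cone {y. F (y, w) \<le> 0} x"
    using v by (simp add: normal_cone_map_def feasible_set_def)
  show "F (x, w) = 0" "v = (v \<bullet> grad_x F x w / (grad_x F x w \<bullet> grad_x F x w)) *\<^sub>R grad_x F x w"
    by (rule limiting_normal_sublevel[where \<phi> = "\<lambda>y. F (y, w)" and g = "\<lambda>y. grad_x F y w",
          OF has_derivative_in_x c g v' v(2)])+
qed

lemma normal_cone_mapI:
  assumes "F (x, w) = 0" "m \<ge> 0"
  shows "m *\<^sub>R grad_x F x w \<in> normal_cone_map F (x, w)"
proof -
  have "m *\<^sub>R grad_x F x w \<in> frechet_normal_cone {y. F (y, w) \<le> 0} x"
    by (rule sublevel_gradient_frechet_normal[OF has_derivative_in_x assms])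
  then show ?thesis
    using frechet_subset_limiting_normal_cone by (auto simp: normal_cone_map_def feasible_set_def)
qed

text \<open>Near \<open>u\<close> the graph satisfies the equations \<open>F z = 0\<close> and
  \<open>v = m *\<^sub>R G z\<close>. Combining them with weights \<open>\<gamma>\<close> and
  \<open>v1\<close> gives a function \<open>\<psi>\<close> that vanishes on the graph and has
  gradient \<open>p\<close> at \<open>u\<close>.\<close>

lemma frechet_coderivative_normal_cone_map:
  assumes F0: "F (xb, wb) = 0" and g: "grad_x F xb wb \<noteq> 0" and lam: "lam > 0"
    and v1: "grad_x F xb wb \<bullet> v1 = 0"
  shows "(lam *\<^sub>R (hess_xx F xb wb *v v1) + \<gamma> *\<^sub>R grad_x F xb wb,
          lam *\<^sub>R (hess_wx F xb wb *v v1) + \<gamma> *\<^sub>R grad_w F xb wb)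
    \<in> frechet_coderivative (normal_cone_map F) (xb, wb) (lam *\<^sub>R grad_x F xb wb) v1"
proof -
  define G where "G = (\<lambda>(x, w). grad_x F x w)"
  define z0 where "z0 = (xb, wb)"
  have Gz: "G z0 = grad_x F xb wb" by (simp add: G_def z0_def)
  define u where "u = (z0, lam *\<^sub>R G z0)"
  define p where "p = ((lam *\<^sub>R (hess_xx F xb wb *v v1) + \<gamma> *\<^sub>R grad_x F xb wb,
          lam *\<^sub>R (hess_wx F xb wb *v v1) + \<gamma> *\<^sub>R grad_w F xb wb), - v1)"
  \<comment> \<open>near \<open>u\<close> every point of the graph is \<open>(z, m y *\<^sub>R G z)\<close> with \<open>F z = 0\<close>\<close>
  define m where "m y = (snd y \<bullet> G (fst y)) / (G (fst y) \<bullet> G (fst y))" for y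
  define \<psi> where "\<psi> y = m y * (v1 \<bullet> G (fst y)) + \<gamma> * F (fst y) - v1 \<bullet> snd y" for y
  have dG: "(G has_derivative dgrad_x F z) (at z)" for z
    unfolding G_def by (rule has_derivative_grad_x[OF F])
  have dGu: "((\<lambda>y. G (fst y)) has_derivative (\<lambda>k. dgrad_x F z0 (fst k))) (at u)"
    using diff_chain_at[OF has_derivative_fst[OF has_derivative_ident], of G "dgrad_x F z0" u] dG
    by (simp add: o_def u_def)
  have dFu: "((\<lambda>y. F (fst y)) has_derivative
      (\<lambda>k. grad_x F xb wb \<bullet> fst (fst k) + grad_w F xb wb \<bullet> snd (fst k))) (at u)"
    using diff_chain_at[OF has_derivative_fst[OF has_derivative_ident], of F _ u]
      has_derivative_grad[OF F, of z0]
    by (simp add: o_def u_def z0_def)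
  have "(m has_derivative frechet_derivative m (at u)) (at u)"
  proof -
    have "(\<lambda>y. snd y \<bullet> G (fst y)) differentiable at u" "(\<lambda>y. G (fst y) \<bullet> G (fst y)) differentiable at u"
      by (rule differentiableI, rule has_derivative_inner,
          (rule dGu has_derivative_snd has_derivative_ident)+)+
    moreover have "G (fst u) \<bullet> G (fst u) \<noteq> 0" using g by (simp add: u_def Gz)
    ultimately have "m differentiable at u"
      unfolding m_def[abs_def] by (intro derivative_intros)
    then show ?thesis by (simp add: frechet_derivative_works)
  qed
  note dm = this
  have mu: "m u = lam" using g by (simp add: m_def u_def Gz)
  \<comment> \<open>This orthogonality removes the product-rule term containing the derivative of
    \<open>m\<close>, so that derivative never has to be computed.\<close>
  have v1': "v1 \<bullet> G (fst u) = 0" using v1 by (simp add: u_def Gz inner_commute)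
  have "(\<psi> has_derivative (\<lambda>k. p \<bullet> k)) (at u)"
  proof -
    have "(\<psi> has_derivative (\<lambda>k. m u * (v1 \<bullet> dgrad_x F z0 (fst k)) +
        frechet_derivative m (at u) k * (v1 \<bullet> G (fst u)) +
        \<gamma> * (grad_x F xb wb \<bullet> fst (fst k) + grad_w F xb wb \<bullet> snd (fst k)) - v1 \<bullet> snd k)) (at u)"
      unfolding \<psi>_def[abs_def]
      by (intro has_derivative_diff has_derivative_add has_derivative_mult dm
          has_derivative_inner_right dGu has_derivative_mult_right dFu has_derivative_snd has_derivative_ident)
    moreover have "m u * (v1 \<bullet> dgrad_x F z0 (fst k)) +
        frechet_derivative m (at u) k * (v1 \<bullet> G (fst u)) +
        \<gamma> * (grad_x F xb wb \<bullet> fst (fst k) + grad_w F xb wb \<bullet> snd (fst k)) - v1 \<bullet> snd k = p \<bullet> k" for k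
      unfolding v1' mu z0_def inner_dgrad_x[OF F]
      by (simp add: p_def inner_prod_def algebra_simps)
    ultimately show ?thesis by simp
  qed
  moreover have "u \<in> gph (normal_cone_map F)"
    using normal_cone_mapI[OF F0, of lam] lam by (simp add: gph_def u_def z0_def G_def)
  moreover have "\<psi> u = 0" using F0 v1 by (simp add: \<psi>_def v1') (simp add: u_def z0_def G_def inner_commute)
  moreover have "\<forall>\<^sub>F y in nhds u. y \<in> gph (normal_cone_map F) \<longrightarrow> \<psi> y = 0"
  proof -
    have "isCont (\<lambda>y. G (fst y)) u" using dGu by (rule has_derivative_continuous)
    then have "((\<lambda>y. G (fst y)) \<longlongrightarrow> G (fst u)) (nhds u)"
      by (simp add: isCont_def tendsto_at_iff_tendsto_nhds[of "\<lambda>y. G (fst y)"])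
    then have "\<forall>\<^sub>F y in nhds u. G (fst y) \<noteq> 0"
      by (rule tendsto_imp_eventually_ne) (use g in \<open>simp add: u_def Gz\<close>)
    \<comment> \<open>The positive multiplier enters here: at \<open>u\<close> the normal vector is
      nonzero, and nearby nonzero normals force the constraint to be active.\<close>
    moreover have "\<forall>\<^sub>F y in nhds u. snd y \<noteq> 0"
    proof (rule tendsto_imp_eventually_ne)
      show "(snd \<longlongrightarrow> snd u) (nhds u)" by (intro tendsto_snd filterlim_ident)
      show "snd u \<noteq> 0" using g lam by (simp add: u_def Gz)
    qed
    ultimately show ?thesis
    proof eventually_elim
      case (elim y)
      show ?case
      proof
        assume "y \<in> gph (normal_cone_map F)"
        then have v: "snd y \<in> normal_cone_map F (fst (fst y), snd (fst y))" by (auto simp: gph_def)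
        have G': "grad_x F (fst (fst y)) (snd (fst y)) = G (fst y)" by (simp add: G_def split_beta)
        have "F (fst y) = 0" "snd y = m y *\<^sub>R G (fst y)"
          using normal_cone_mapD[OF v elim(2)] elim(1) unfolding G' m_def by simp_all
        then show "\<psi> y = 0" unfolding \<psi>_def by (metis add.right_neutral cancel_comm_monoid_add_class.diff_cancel inner_scaleR_right mult_zero_right)
      qed
    qed
  qed
  ultimately have "p \<in> frechet_normal_cone (gph (normal_cone_map F)) u"
    by (rule frechet_normal_of_vanishing)
  then show ?thesis
    by (simp add: frechet_coderivative_def p_def u_def z0_def G_def)
qed

end

section \<open>The stationary map\<close>

text \<open>This exhibits the graph of \<open>S\<close> as the preimage of the graph of
  \<open>M\<close> under the map \<open>(w, x) \<mapsto> ((x, w), - grad_x f0 x w)\<close>, the form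
  required by the chain rule.\<close>

lemma mem_stationary_map_iff:
  "x \<in> stationary_map f0 F w \<longleftrightarrow> - grad_x f0 x w \<in> normal_cone_map F (x, w)"
  by (simp add: stationary_map_def normal_cone_map_def elt_set_plus_def eq_neg_iff_add_eq_0)
    (metis add.commute eq_neg_iff_add_eq_0)

text \<open>The multiplier is a variable of its own and the constraint is an equation, so the zero
  set is a level set. The variables come as \<open>((x, w), l)\<close>, whereas the graph of
  \<open>S\<close> consists of pairs \<open>(w, x)\<close>.\<close>

definition kkt_map ::
    "((real^'n) \<times> (real^'d) \<Rightarrow> real) \<Rightarrow> ((real^'n) \<times> (real^'d) \<Rightarrow> real) \<Rightarrow>
     ((real^'n) \<times> (real^'d)) \<times> real \<Rightarrow> (real^'n) \<times> real" where
  "kkt_map f0 F = (\<lambda>((x, w), l). (grad_x f0 x w + l *\<^sub>R grad_x F x w, F (x, w)))"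

definition dkkt ::
    "((real^'n) \<times> (real^'d) \<Rightarrow> real) \<Rightarrow> ((real^'n) \<times> (real^'d) \<Rightarrow> real) \<Rightarrow>
     ((real^'n) \<times> (real^'d)) \<times> real \<Rightarrow> ((real^'n) \<times> (real^'d)) \<times> real \<Rightarrow> (real^'n) \<times> real" where
  "dkkt f0 F = (\<lambda>((x, w), l) k.
     (dgrad_x f0 (x, w) (fst k) + l *\<^sub>R dgrad_x F (x, w) (fst k) + snd k *\<^sub>R grad_x F x w,
      grad_x F x w \<bullet> fst (fst k) + grad_w F x w \<bullet> snd (fst k)))"

section \<open>Derivative of the KKT system and normals to the graph of the stationary map\<close>

context
  fixes f0 F :: "(real^'n) \<times> (real^'d) \<Rightarrow> real"
  assumes f0: "twice_cont_diff f0" and F: "twice_cont_diff F"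
begin

lemma has_derivative_kkt: "(kkt_map f0 F has_derivative dkkt f0 F z) (at z)"
proof -
  define Gf where "Gf = (\<lambda>(x, w). grad_x f0 x w)"
  define GF where "GF = (\<lambda>(x, w). grad_x F x w)"
  note fd = has_derivative_fst[OF has_derivative_ident, of "at z"]
  have dGf: "((\<lambda>y. Gf (fst y)) has_derivative (\<lambda>k. dgrad_x f0 (fst z) (fst k))) (at z)"
    using diff_chain_at[OF fd, of Gf] has_derivative_grad_x[OF f0, of "fst z"] by (simp add: o_def Gf_def)
  have dGF: "((\<lambda>y. GF (fst y)) has_derivative (\<lambda>k. dgrad_x F (fst z) (fst k))) (at z)"
    using diff_chain_at[OF fd, of GF] has_derivative_grad_x[OF F, of "fst z"] by (simp add: o_def GF_def)
  have dF: "((\<lambda>y. F (fst y)) has_derivative (\<lambda>k. grad_x F (fst (fst z)) (snd (fst z)) \<bullet> fst (fst k)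
       + grad_w F (fst (fst z)) (snd (fst z)) \<bullet> snd (fst k))) (at z)"
    using diff_chain_at[OF fd, of F] has_derivative_grad[OF F, of "fst z"] by (simp add: o_def)
  have "kkt_map f0 F = (\<lambda>y. (Gf (fst y) + snd y *\<^sub>R GF (fst y), F (fst y)))"
    by (auto simp: kkt_map_def Gf_def GF_def)
  moreover have "dkkt f0 F z = (\<lambda>k. (dgrad_x f0 (fst z) (fst k) +
      (snd z *\<^sub>R dgrad_x F (fst z) (fst k) + snd k *\<^sub>R GF (fst z)),
      grad_x F (fst (fst z)) (snd (fst z)) \<bullet> fst (fst k)
       + grad_w F (fst (fst z)) (snd (fst z)) \<bullet> snd (fst k)))"
    by (auto simp: dkkt_def GF_def split_beta)
  ultimately show ?thesis
    by (simp only:)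
      (intro has_derivative_Pair has_derivative_add has_derivative_scaleR dGf dGF dF
        has_derivative_snd has_derivative_ident)
qed

lemma linear_dkkt: "linear (dkkt f0 F z)"
  by (rule has_derivative_linear) (rule has_derivative_kkt)

lemma continuous_dkkt: "continuous_on UNIV (\<lambda>z. dkkt f0 F z k)"
proof -
  have c: "continuous_on UNIV (\<lambda>z :: ((real^'n) \<times> (real^'d)) \<times> real. g (fst z))"
    if "continuous_on UNIV g" for g :: "(real^'n) \<times> (real^'d) \<Rightarrow> 'e::topological_space"
    using continuous_on_compose2[OF that continuous_on_fst[OF continuous_on_id]] by auto
  note cs = c[OF continuous_dgrad_x[OF f0]] c[OF continuous_dgrad_x[OF F]]
    c[OF continuous_grad_x[OF F]] c[OF continuous_grad_w[OF F]]
  show ?thesis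
    unfolding dkkt_def split_beta prod.collapse
    using cs unfolding split_beta
    by (intro continuous_intros)
qed

text \<open>This links the analysis to the data of the theorem: equating the adjoint at the
  reference point with \<open>((- x', w'), 0)\<close> gives the system defining
  \<open>Gamma2\<close>, and equating it with zero gives the kernel condition. The last component
  belongs to the multiplier variable.\<close>

lemma adjoint_dkkt:
  "adjoint (dkkt f0 F ((x, w), l)) = (\<lambda>(v, \<gamma>).
     (((hess_xx f0 x w + l *\<^sub>R hess_xx F x w) *v v + \<gamma> *\<^sub>R grad_x F x w,
       (hess_wx f0 x w + l *\<^sub>R hess_wx F x w) *v v + \<gamma> *\<^sub>R grad_w F x w),
      grad_x F x w \<bullet> v))"
proof (rule adjoint_unique, intro allI)
  fix k :: "((real^'n) \<times> (real^'d)) \<times> real" and y :: "(real^'n) \<times> real"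
  obtain v \<gamma> where y: "y = (v, \<gamma>)" by fastforce
  have "dkkt f0 F ((x, w), l) k \<bullet> y =
      v \<bullet> dgrad_x f0 (x, w) (fst k) + l * (v \<bullet> dgrad_x F (x, w) (fst k)) + snd k * (v \<bullet> grad_x F x w)
      + \<gamma> * (grad_x F x w \<bullet> fst (fst k) + grad_w F x w \<bullet> snd (fst k))"
    by (simp add: dkkt_def y inner_prod_def inner_commute[of _ v] inner_add_right)
  also have "\<dots> = k \<bullet> ((\<lambda>(v, \<gamma>).
     (((hess_xx f0 x w + l *\<^sub>R hess_xx F x w) *v v + \<gamma> *\<^sub>R grad_x F x w,
       (hess_wx f0 x w + l *\<^sub>R hess_wx F x w) *v v + \<gamma> *\<^sub>R grad_w F x w),
      grad_x F x w \<bullet> v)) y)"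
    unfolding inner_dgrad_x[OF f0] inner_dgrad_x[OF F]
    by (simp add: y inner_prod_def inner_add_right matrix_vector_mult_add_rdistrib
        scaleR_matrix_vector_assoc[symmetric] inner_commute algebra_simps)
  finally show "dkkt f0 F ((x, w), l) k \<bullet> y = k \<bullet> ((\<lambda>(v, \<gamma>).
     (((hess_xx f0 x w + l *\<^sub>R hess_xx F x w) *v v + \<gamma> *\<^sub>R grad_x F x w,
       (hess_wx f0 x w + l *\<^sub>R hess_wx F x w) *v v + \<gamma> *\<^sub>R grad_w F x w),
      grad_x F x w \<bullet> v)) y)" .
qed

lemma kkt_stationary:
  assumes "kkt_map f0 F ((x, w), l) = 0" "l \<ge> 0"
  shows "x \<in> stationary_map f0 F w"
proof -
  have "F (x, w) = 0" "- grad_x f0 x w = l *\<^sub>R grad_x F x w"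
    using assms by (auto simp: kkt_map_def zero_prod_def eq_neg_iff_add_eq_0 neg_eq_iff_add_eq_0)
  then show ?thesis
    using normal_cone_mapI[OF F, of x w l] assms(2) by (simp add: mem_stationary_map_iff)
qed

text \<open>Dropping the multiplier from a curve of KKT points gives a curve in the graph as long as
  the multiplier stays positive, which holds for small \<open>t\<close>. So the normal, extended by
  zero, is nonpositive on the kernel of the derivative; applying this to \<open>h\<close> and
  \<open>- h\<close> gives orthogonality.\<close>

lemma frechet_normal_stationary_map:
  assumes n: "(b, a) \<in> frechet_normal_cone (gph (stationary_map f0 F)) (w, x)"
    and z: "kkt_map f0 F ((x, w), l) = 0" and l: "l > 0" and s: "surj (dkkt f0 F ((x, w), l))"
  shows "((a, b), 0) \<in> range (adjoint (dkkt f0 F ((x, w), l)))"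
proof (rule orthogonal_ker_imp_range_adjoint[OF linear_dkkt])
  have le: "((a, b), 0) \<bullet> h \<le> 0" if h: "dkkt f0 F ((x, w), l) h = 0" for h
  proof -
    obtain \<zeta> where \<zeta>: "(\<zeta> has_vector_derivative h) (at 0)" "\<zeta> 0 = ((x, w), l)"
      "\<forall>\<^sub>F t in at_right (0::real). kkt_map f0 F (\<zeta> t) = 0"
      by (rule level_set_curve[OF has_derivative_kkt continuous_dkkt s z h])
    define \<pi> where "\<pi> y = (snd (fst y), fst (fst y))" for y :: "((real^'n) \<times> (real^'d)) \<times> real"
    have "bounded_linear \<pi>"
      unfolding \<pi>_def[abs_def] by (intro bounded_linear_intros)
    then have "((\<lambda>t. \<pi> (\<zeta> t)) has_vector_derivative \<pi> h) (at 0)"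
      using \<zeta>(1) by (rule bounded_linear.has_vector_derivative)
    moreover have "\<pi> (\<zeta> 0) = (w, x)" by (simp add: \<zeta>(2) \<pi>_def)
    moreover have "\<forall>\<^sub>F t in at_right 0. \<pi> (\<zeta> t) \<in> gph (stationary_map f0 F)"
    proof -
      have "isCont \<zeta> 0" using \<zeta>(1) by (rule has_vector_derivative_continuous)
      then have "(\<zeta> \<longlongrightarrow> ((x, w), l)) (at_right 0)"
        by (auto simp: isCont_def \<zeta>(2) intro: filterlim_mono at_le)
      then have "((\<lambda>t. snd (\<zeta> t)) \<longlongrightarrow> l) (at_right 0)" by (auto dest: tendsto_snd)
      then have "\<forall>\<^sub>F t in at_right 0. snd (\<zeta> t) > 0" using l by (rule order_tendstoD)
      with \<zeta>(3) show ?thesis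
      proof eventually_elim
        case (elim t)
        then show ?case
          using kkt_stationary[of "fst (fst (\<zeta> t))" "snd (fst (\<zeta> t))" "snd (\<zeta> t)"]
          by (simp add: gph_def \<pi>_def)
      qed
    qed
    ultimately have "(b, a) \<bullet> \<pi> h \<le> 0" by (rule frechet_normal_tangent[OF n])
    then show ?thesis by (simp add: \<pi>_def inner_prod_def)
  qed
  show "((a, b), 0) \<bullet> h = 0" if h: "dkkt f0 F ((x, w), l) h = 0" for h
  proof -
    have "dkkt f0 F ((x, w), l) (- h) = 0" by (simp add: linear_neg[OF linear_dkkt] h)
    from le[OF h] le[OF this] show ?thesis by simp
  qed
qed

text \<open>A nonzero normal vector forces the constraint to be active. Its projection coefficient
  is an explicit multiplier, whose continuity later yields its sign near the reference
  point.\<close>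

lemma stationary_kkt:
  assumes "x \<in> stationary_map f0 F w" "grad_x F x w \<noteq> 0" "grad_x f0 x w \<noteq> 0"
  shows "kkt_map f0 F ((x, w), (- grad_x f0 x w \<bullet> grad_x F x w) / (grad_x F x w \<bullet> grad_x F x w)) = 0"
  using normal_cone_mapD[OF F _ _ assms(2), of "- grad_x f0 x w"] assms
  by (simp add: kkt_map_def mem_stationary_map_iff zero_prod_def add_eq_0_iff)

section \<open>The inclusions at the reference point\<close>

context
  fixes xb :: "real^'n" and wb :: "real^'d" and lam :: real
  assumes Fb: "F (xb, wb) = 0" and gb: "grad_x F xb wb \<noteq> 0"
    and mult: "grad_x f0 xb wb + lam *\<^sub>R grad_x F xb wb = 0" and lam: "lam > 0"
begin

text \<open>With the same \<open>v1\<close>, the \<open>f0\<close> terms of the system are the shift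
  in \<open>Gamma_hat\<close>, and the remaining terms form the explicit coderivative element of the
  normal cone map.\<close>

lemma Gamma2_subset_Gamma_hat: "Gamma2 f0 F lam xb wb x' \<subseteq> Gamma_hat f0 F xb wb x'"
proof
  fix w' assume "w' \<in> Gamma2 f0 F lam xb wb x'"
  then obtain v1 \<gamma> where w': "w' = (hess_wx f0 xb wb + lam *\<^sub>R hess_wx F xb wb) *v v1 + \<gamma> *\<^sub>R grad_w F xb wb"
    and x': "- x' = (hess_xx f0 xb wb + lam *\<^sub>R hess_xx F xb wb) *v v1 + \<gamma> *\<^sub>R grad_x F xb wb"
    and v1: "grad_x F xb wb \<bullet> v1 = 0"
    unfolding Gamma2_def by auto
  define p where "p = (lam *\<^sub>R (hess_xx F xb wb *v v1) + \<gamma> *\<^sub>R grad_x F xb wb,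
      lam *\<^sub>R (hess_wx F xb wb *v v1) + \<gamma> *\<^sub>R grad_w F xb wb)"
  have "p \<in> frechet_coderivative (normal_cone_map F) (xb, wb) (lam *\<^sub>R grad_x F xb wb) v1"
    unfolding p_def by (rule frechet_coderivative_normal_cone_map[OF F Fb gb lam v1])
  also have "lam *\<^sub>R grad_x F xb wb = - grad_x f0 xb wb"
    using mult by (simp add: eq_neg_iff_add_eq_0 add.commute)
  finally have "p \<in> frechet_coderivative (normal_cone_map F) (xb, wb) (- grad_x f0 xb wb) v1" .
  moreover have "(- x', w') = (hess_xx f0 xb wb *v v1, hess_wx f0 xb wb *v v1) + p"
    by (simp add: x' w' p_def matrix_vector_mult_add_rdistrib scaleR_matrix_vector_assoc[symmetric])
  ultimately show "w' \<in> Gamma_hat f0 F xb wb x'"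
    unfolding Gamma_hat_def elt_set_plus_def by blast
qed

text \<open>A normal to the graph of \<open>M\<close> is pulled back along \<open>f\<close>. The
  component \<open>- v1\<close> meets \<open>- dgrad_x\<close>, and the product contributes exactly
  the Hessian terms of \<open>f0\<close>.\<close>

lemma Gamma_hat_subset_frechet_coderivative:
  "Gamma_hat f0 F xb wb x' \<subseteq> frechet_coderivative (stationary_map f0 F) wb xb x'"
proof
  fix w' assume "w' \<in> Gamma_hat f0 F xb wb x'"
  then obtain v1 a b where ab: "(a, b) \<in> frechet_coderivative (normal_cone_map F) (xb, wb) (- grad_x f0 xb wb) v1"
    and xw: "- x' = hess_xx f0 xb wb *v v1 + a" "w' = hess_wx f0 xb wb *v v1 + b"
    unfolding Gamma_hat_def elt_set_plus_def by auto
  define \<sigma> where "\<sigma> = (\<lambda>y :: (real^'d) \<times> (real^'n). (snd y, fst y))"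
  define f where "f y = (\<sigma> y, - (\<lambda>(x, w). grad_x f0 x w) (\<sigma> y))" for y
  have d\<sigma>: "(\<sigma> has_derivative \<sigma>) (at y)" for y
    unfolding \<sigma>_def by (auto intro!: derivative_eq_intros)
  have f: "f (w, x) = ((x, w), - grad_x f0 x w)" for w x by (simp add: f_def \<sigma>_def)
  have \<sigma>b: "\<sigma> (wb, xb) = (xb, wb)" by (simp add: \<sigma>_def)
  have "((\<lambda>y. (\<lambda>(x, w). grad_x f0 x w) (\<sigma> y)) has_derivative (\<lambda>k. dgrad_x f0 (xb, wb) (\<sigma> k))) (at (wb, xb))"
    using diff_chain_at[OF d\<sigma>[of "(wb, xb)"], of "\<lambda>(x, w). grad_x f0 x w"]
      has_derivative_grad_x[OF f0, of "(xb, wb)"] by (simp add: o_def \<sigma>b)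
  then have der: "(f has_derivative (\<lambda>k. (\<sigma> k, - dgrad_x f0 (xb, wb) (\<sigma> k)))) (at (wb, xb))"
    unfolding f_def[abs_def] by (intro has_derivative_Pair d\<sigma> has_derivative_minus)
  have n: "((a, b), - v1) \<in> frechet_normal_cone (gph (normal_cone_map F)) (f (wb, xb))"
    using ab by (simp add: frechet_coderivative_def f)
  then have mem: "(wb, xb) \<in> gph (stationary_map f0 F)"
    by (simp add: frechet_normal_cone_iff gph_def f mem_stationary_map_iff)
  have img: "f ` gph (stationary_map f0 F) \<subseteq> gph (normal_cone_map F)"
    by (auto simp: gph_def f mem_stationary_map_iff)
  have "(w', - x') \<bullet> k = ((a, b), - v1) \<bullet> (\<sigma> k, - dgrad_x f0 (xb, wb) (\<sigma> k))" for k
  proof -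
    have "((a, b), - v1) \<bullet> (\<sigma> k, - dgrad_x f0 (xb, wb) (\<sigma> k)) =
        a \<bullet> snd k + b \<bullet> fst k + v1 \<bullet> dgrad_x f0 (xb, wb) (\<sigma> k)"
      by (simp add: inner_prod_def \<sigma>_def)
    then show ?thesis
      unfolding inner_dgrad_x[OF f0] by (simp add: inner_prod_def \<sigma>_def xw inner_add_left)
  qed
  from frechet_normal_cone_preimage[OF der mem img n this]
  show "w' \<in> frechet_coderivative (stationary_map f0 F) wb xb x'"
    by (simp add: frechet_coderivative_def)
qed

lemma limiting_coderivative_subset_Gamma2:
  assumes ker: "ker (A1 f0 F lam xb wb) \<inter> ker (A2 f0 F lam xb wb)
           \<inter> (ker (\<lambda>v. grad_x F xb wb \<bullet> v) \<times> UNIV) = {(0, 0)}"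
  shows "limiting_coderivative (stationary_map f0 F) wb xb x' \<subseteq> Gamma2 f0 F lam xb wb x'"
proof
  fix w' assume "w' \<in> limiting_coderivative (stationary_map f0 F) wb xb x'"
  then obtain V V' where V: "V \<longlonglongrightarrow> (wb, xb)" "V' \<longlonglongrightarrow> (w', - x')"
    and n: "\<And>k. V' k \<in> frechet_normal_cone (gph (stationary_map f0 F)) (V k)"
    unfolding limiting_coderivative_def limiting_normal_cone_def by (auto split: if_splits)
  let ?zb = "((xb, wb), lam)"
  \<comment> \<open>The kernel condition is injectivity of the adjoint, that is, surjectivity of the
    derivative of the KKT system.\<close>
  have surj: "surj (dkkt f0 F ?zb)"
  proof (subst inj_adjoint_iff_surj[OF linear_dkkt, symmetric],
      subst linear_injective_0[OF adjoint_linear[OF linear_dkkt]], intro allI impI)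
    fix y assume y: "adjoint (dkkt f0 F ?zb) y = 0"
    obtain v \<gamma> where vg: "y = (v, \<gamma>)" by fastforce
    have "y \<in> ker (A1 f0 F lam xb wb) \<inter> ker (A2 f0 F lam xb wb)
           \<inter> (ker (\<lambda>v. grad_x F xb wb \<bullet> v) \<times> UNIV)"
      using y by (simp add: vg adjoint_dkkt ker_def A1_def A2_def append_column_def zero_prod_def)
    then show "y = 0" unfolding ker by (simp add: zero_prod_def)
  qed
  \<comment> \<open>The multiplier at nearby stationary points is given by this formula. It is
    continuous near the reference point and equals \<open>lam\<close> there, so \<open>Z\<close>
    converges and the multipliers are eventually positive.\<close>
  define m where "m z = (- grad_x f0 (fst z) (snd z) \<bullet> grad_x F (fst z) (snd z)) /
      (grad_x F (fst z) (snd z) \<bullet> grad_x F (fst z) (snd z))" for z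
  define z where "z k = (snd (V k), fst (V k))" for k
  have z: "z \<longlonglongrightarrow> (xb, wb)"
    unfolding z_def[abs_def] using tendsto_Pair[OF tendsto_snd[OF V(1)] tendsto_fst[OF V(1)]] by simp
  have lim: "(\<lambda>k. grad_x h (fst (z k)) (snd (z k))) \<longlonglongrightarrow> grad_x h xb wb" if "twice_cont_diff h" for h
    using continuous_on_tendsto_compose[OF continuous_grad_x[OF that] z] by (simp add: split_beta)
  have f0b: "grad_x f0 xb wb = - (lam *\<^sub>R grad_x F xb wb)"
    using mult by (simp add: eq_neg_iff_add_eq_0)
  have mlim: "(\<lambda>k. m (z k)) \<longlonglongrightarrow> lam"
  proof -
    have "(\<lambda>k. m (z k)) \<longlonglongrightarrow> (- grad_x f0 xb wb \<bullet> grad_x F xb wb) / (grad_x F xb wb \<bullet> grad_x F xb wb)"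
      unfolding m_def by (intro tendsto_intros lim f0 F) (use gb in simp)
    then show ?thesis using gb by (simp add: f0b)
  qed
  define Z where "Z k = (z k, m (z k))" for k
  have Z: "Z \<longlonglongrightarrow> ?zb" unfolding Z_def[abs_def] by (intro tendsto_Pair z mlim)
  define U where "U k = ((snd (V' k), fst (V' k)), 0 :: real)" for k
  have U: "U \<longlonglongrightarrow> ((- x', w'), 0)"
    unfolding U_def[abs_def]
    using tendsto_Pair[OF tendsto_Pair[OF tendsto_snd[OF V(2)] tendsto_fst[OF V(2)]] tendsto_const] by simp
  obtain c where c: "\<forall>\<^sub>F y in nhds ?zb. surj (dkkt f0 F y) \<and> (\<forall>p. c * norm p \<le> norm (adjoint (dkkt f0 F y) p))"
    by (rule eventually_surj[where A = "dkkt f0 F", OF linear_dkkt continuous_dkkt surj])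
  have s: "\<forall>\<^sub>F k in sequentially. surj (dkkt f0 F (Z k))"
    using eventually_compose_filterlim[OF c Z] by eventually_elim simp
  have ne1: "\<forall>\<^sub>F k in sequentially. grad_x F (fst (z k)) (snd (z k)) \<noteq> 0"
    using lim[OF F] gb by (rule tendsto_imp_eventually_ne)
  \<comment> \<open>At the reference point the gradient of \<open>f0\<close> is \<open>- lam\<close>
    times that of \<open>F\<close>, hence nonzero; \<open>stationary_kkt\<close> asks for this at
    nearby points.\<close>
  have ne2: "\<forall>\<^sub>F k in sequentially. grad_x f0 (fst (z k)) (snd (z k)) \<noteq> 0"
    using lim[OF f0] by (rule tendsto_imp_eventually_ne) (use gb lam f0b in simp)
  have pos: "\<forall>\<^sub>F k in sequentially. m (z k) > 0"
    using mlim lam by (rule order_tendstoD)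
  have "((- x', w'), 0) \<in> range (adjoint (dkkt f0 F ?zb))"
  proof (rule range_adjoint_limit[where A = "dkkt f0 F", OF linear_dkkt continuous_dkkt surj Z U])
    from s ne1 ne2 pos show "\<forall>\<^sub>F k in sequentially. U k \<in> range (adjoint (dkkt f0 F (Z k)))"
    proof eventually_elim
      case (elim k)
      obtain w x where v: "V k = (w, x)" by fastforce
      obtain b a where v': "V' k = (b, a)" by fastforce
      have zk: "z k = (x, w)" by (simp add: z_def v)
      have nk: "(b, a) \<in> frechet_normal_cone (gph (stationary_map f0 F)) (w, x)"
        using n[of k] by (simp add: v v')
      then have "x \<in> stationary_map f0 F w" by (simp add: frechet_normal_cone_iff gph_def)
      then have "kkt_map f0 F ((x, w), m (x, w)) = 0"
        using stationary_kkt elim by (simp add: m_def zk)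
      from frechet_normal_stationary_map[OF nk this] elim
      show ?case by (simp add: U_def Z_def zk v')
    qed
  qed
  then obtain v1 \<gamma> where
    "- x' = (hess_xx f0 xb wb + lam *\<^sub>R hess_xx F xb wb) *v v1 + \<gamma> *\<^sub>R grad_x F xb wb"
    "w' = (hess_wx f0 xb wb + lam *\<^sub>R hess_wx F xb wb) *v v1 + \<gamma> *\<^sub>R grad_w F xb wb"
    "grad_x F xb wb \<bullet> v1 = 0"
    unfolding adjoint_dkkt by auto
  then show "w' \<in> Gamma2 f0 F lam xb wb x'"
    unfolding Gamma2_def mem_Collect_eq by metis
qed

end

end

lemma frechet_subset_limiting_coderivative:
  "frechet_coderivative \<Phi> u y y' \<subseteq> limiting_coderivative \<Phi> u y y'"
  unfolding frechet_coderivative_def limiting_coderivative_def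
  using frechet_subset_limiting_normal_cone by blast

theorem mainTheorem5:
  fixes f0 F :: "(real^'n) \<times> (real^'d) \<Rightarrow> real"
    and xb :: "real^'n" and wb :: "real^'d" and lam :: real
  assumes "twice_cont_diff f0"
    and "twice_cont_diff F"
    and "xb \<in> stationary_map f0 F wb"
    and "F (xb, wb) = 0"
    and "grad_x F xb wb \<noteq> 0"
    and "grad_x f0 xb wb + lam *\<^sub>R grad_x F xb wb = 0"
    and "lam > 0"
    and "ker (A1 f0 F lam xb wb) \<inter> ker (A2 f0 F lam xb wb)
           \<inter> (ker (\<lambda>v. grad_x F xb wb \<bullet> v) \<times> UNIV) = {(0, 0)}"
  shows "\<forall>x'. Gamma_hat f0 F xb wb x' = frechet_coderivative (stationary_map f0 F) wb xb x' \<and>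
              frechet_coderivative (stationary_map f0 F) wb xb x'
                = limiting_coderivative (stationary_map f0 F) wb xb x' \<and>
              limiting_coderivative (stationary_map f0 F) wb xb x' = Gamma2 f0 F lam xb wb x'"
proof
  fix x'
  have "Gamma_hat f0 F xb wb x' \<subseteq> frechet_coderivative (stationary_map f0 F) wb xb x'"
    by (rule Gamma_hat_subset_frechet_coderivative) fact+
  moreover have "frechet_coderivative (stationary_map f0 F) wb xb x'
      \<subseteq> limiting_coderivative (stationary_map f0 F) wb xb x'"
    by (rule frechet_subset_limiting_coderivative)
  moreover have "limiting_coderivative (stationary_map f0 F) wb xb x' \<subseteq> Gamma2 f0 F lam xb wb x'"
    by (rule limiting_coderivative_subset_Gamma2) fact+
  moreover have "Gamma2 f0 F lam xb wb x' \<subseteq> Gamma_hat f0 F xb wb x'"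
    by (rule Gamma2_subset_Gamma_hat) fact+
  ultimately show "Gamma_hat f0 F xb wb x' = frechet_coderivative (stationary_map f0 F) wb xb x' \<and>
              frechet_coderivative (stationary_map f0 F) wb xb x'
                = limiting_coderivative (stationary_map f0 F) wb xb x' \<and>
              limiting_coderivative (stationary_map f0 F) wb xb x' = Gamma2 f0 F lam xb wb x'"
    by blast
qed

end
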